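(* Let $(T,\bm\omega_0)$ be a polygonal tiling of a closed connected surface $X$, where $\bm\omega_0$ assigns to each edge of $T$ the geodesic distance between its two endpoints. Assume that the $1$-skeleton $G=(V,E)$ of $T$, $E=\{e_1,\dots,e_n\}$, is a regular graph or a semi-regular bipartite graph, with girth greater than $5$. Let $\bar\kappa=2\left(\frac{|V|}{|E|}-1\right)$. Then the solution $\bm\omega(t)$ on $G$ of $$\frac{d}{dt}\omega_i(t)=-(\kappa_i(\bm\omega(t))-\bar\kappa)\,\omega_i(t),\quad i=1,\dots,n,\qquad \bm\omega(0)=\bm\omega_0,$$ converges as $t\to\infty$ to a constant weight, i.e. there is $c>0$ such that $\lim_{t\to\infty}\omega_i(t)=c$ for every $i$; regarded as edge lengths on $T$, the limit corresponds to a polygonal partition of the surface with constant edge lengths.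
   Context: A polygonal tiling of a closed surface is a finite decomposition into polygonal faces; its $1$-skeleton is the finite connected simple graph formed by its vertices and edges. The geodesic distances in $\bm\omega_0$ are positive. A graph is regular if all vertices have the same degree; it is semi-regular bipartite if it is bipartite with parts $V_a,V_b$ such that all vertices of $V_a$ have degree $a$ and all vertices of $V_b$ have degree $b$. The girth is the length of a shortest cycle. A weight is a vector $\bm\omega\in\mathbb{R}^n_{>0}$ with $\omega_i=\omega(e_i)$; $\omega_{xy}=\omega_{yx}$ is the weight of edge $(x,y)$. Write $y\sim x$ if $(x,y)\in E$, and $m(x)=\sum_{y\sim x}\omega_{xy}$. The distance $d(u,v)$ on $G$ used to define curvature is the combinatorial one (number of edges of a shortest path) and does not depend on weights or time. Lin-Lu-Yau curvature: for $x\in V$ and $\alpha\in(0,1)$ let $m_x^\alpha$ be the probability measure with $m_x^\alpha(x)=\alpha$, $m_x^\alpha(y)=(1-\alpha)\omega_{xy}/m(x)$ for $y\sim x$, and $0$ otherwise. For $x\ne y$, $\kappa(x,y)=\lim_{\alpha\to1^-}\frac{1}{1-\alpha}\left(1-\frac{W(m_x^\alpha,m_y^\alpha)}{d(x,y)}\right)$, where $W$ is the $1$-Wasserstein distance with respect to $d$. For an edge $e_i=(x,y)$ put $\kappa_i(\bm\omega)=\kappa(x,y)$. On a graph with girth at least $6$ one has, for every edge $e=(x,y)$, $\kappa_e=2\omega_e\left(\frac1{m(x)}+\frac1{m(y)}\right)-2$. *)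

theory Defs
  imports "HOL-Analysis.Analysis" "HOL-Library.Extended_Nat"
begin

section \<open>Weighted graphs, Lin-Lu-Yau curvature and the curvature flow\<close>

text \<open>
  A simple graph is a vertex set \<open>V\<close> with a set \<open>E\<close> of two-element subsets of \<open>V\<close>.
  A weight is a function on \<open>E\<close>, so \<open>\<omega> {x, y}\<close> is the weight of the edge joining \<open>x\<close> and \<open>y\<close>.
\<close>

definition simple_graph :: "'v set \<Rightarrow> 'v set set \<Rightarrow> bool" where
  "simple_graph V E \<longleftrightarrow> finite V \<and> (\<forall>e\<in>E. e \<subseteq> V \<and> card e = 2)"

definition adj_rel :: "'v set set \<Rightarrow> ('v \<times> 'v) set" where
  "adj_rel E = {(x, y). {x, y} \<in> E}"

definition nbrs :: "'v set set \<Rightarrow> 'v \<Rightarrow> 'v set" where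
  "nbrs E x = {y. {x, y} \<in> E}"

definition connected_graph :: "'v set \<Rightarrow> 'v set set \<Rightarrow> bool" where
  "connected_graph V E \<longleftrightarrow> V \<noteq> {} \<and> (\<forall>x\<in>V. \<forall>y\<in>V. (x, y) \<in> (adj_rel E)\<^sup>*)"

definition regular_graph :: "'v set \<Rightarrow> 'v set set \<Rightarrow> bool" where
  "regular_graph V E \<longleftrightarrow> (\<exists>k. \<forall>x\<in>V. card (nbrs E x) = k)"

definition semiregular_bipartite :: "'v set \<Rightarrow> 'v set set \<Rightarrow> bool" where
  "semiregular_bipartite V E \<longleftrightarrow>
     (\<exists>Va Vb a b. Va \<union> Vb = V \<and> Va \<inter> Vb = {} \<and>
        (\<forall>e\<in>E. \<exists>x\<in>Va. \<exists>y\<in>Vb. e = {x, y}) \<and>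
        (\<forall>x\<in>Va. card (nbrs E x) = a) \<and> (\<forall>y\<in>Vb. card (nbrs E y) = b))"

definition graph_cycle :: "'v set set \<Rightarrow> 'v list \<Rightarrow> bool" where
  "graph_cycle E xs \<longleftrightarrow> 3 \<le> length xs \<and> distinct xs \<and>
     (\<forall>i < length xs. {xs ! i, xs ! (Suc i mod length xs)} \<in> E)"

text \<open>The girth of an acyclic graph is \<open>\<infinity>\<close>.\<close>

definition girth :: "'v set set \<Rightarrow> enat" where
  "girth E = (INF xs \<in> {xs. graph_cycle E xs}. enat (length xs))"

text \<open>The \<open>n\<close>-th power of \<open>adj_rel E\<close> relates the pairs joined by a walk with \<open>n\<close> edges.\<close>

definition graph_dist :: "'v set set \<Rightarrow> 'v \<Rightarrow> 'v \<Rightarrow> nat" where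
  "graph_dist E x y = (LEAST n. (x, y) \<in> adj_rel E ^^ n)"

definition vertex_weight :: "'v set set \<Rightarrow> ('v set \<Rightarrow> real) \<Rightarrow> 'v \<Rightarrow> real" where
  "vertex_weight E \<omega> x = (\<Sum>y\<in>nbrs E x. \<omega> {x, y})"

definition lazy_measure :: "'v set set \<Rightarrow> ('v set \<Rightarrow> real) \<Rightarrow> real \<Rightarrow> 'v \<Rightarrow> 'v \<Rightarrow> real" where
  "lazy_measure E \<omega> \<alpha> x z =
     (if z = x then \<alpha>
      else if z \<in> nbrs E x then (1 - \<alpha>) * \<omega> {x, z} / vertex_weight E \<omega> x
      else 0)"

definition coupling :: "'v set \<Rightarrow> ('v \<Rightarrow> real) \<Rightarrow> ('v \<Rightarrow> real) \<Rightarrow> ('v \<Rightarrow> 'v \<Rightarrow> real) \<Rightarrow> bool" where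
  "coupling V \<mu> \<nu> \<pi> \<longleftrightarrow>
     (\<forall>u\<in>V. \<forall>v\<in>V. 0 \<le> \<pi> u v) \<and>
     (\<forall>u\<in>V. (\<Sum>v\<in>V. \<pi> u v) = \<mu> u) \<and> (\<forall>v\<in>V. (\<Sum>u\<in>V. \<pi> u v) = \<nu> v)"

definition wasserstein :: "'v set \<Rightarrow> 'v set set \<Rightarrow> ('v \<Rightarrow> real) \<Rightarrow> ('v \<Rightarrow> real) \<Rightarrow> real" where
  "wasserstein V E \<mu> \<nu> =
     Inf {(\<Sum>u\<in>V. \<Sum>v\<in>V. real (graph_dist E u v) * \<pi> u v) | \<pi>. coupling V \<mu> \<nu> \<pi>}"

definition lly_curvature :: "'v set \<Rightarrow> 'v set set \<Rightarrow> ('v set \<Rightarrow> real) \<Rightarrow> 'v \<Rightarrow> 'v \<Rightarrow> real" where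
  "lly_curvature V E \<omega> x y =
     Lim (at_left 1) (\<lambda>\<alpha>. 1 / (1 - \<alpha>) *
       (1 - wasserstein V E (lazy_measure E \<omega> \<alpha> x) (lazy_measure E \<omega> \<alpha> y)
              / real (graph_dist E x y)))"

definition average_curvature :: "'v set \<Rightarrow> 'v set set \<Rightarrow> real" where
  "average_curvature V E = 2 * (real (card V) / real (card E) - 1)"

definition flow_solution ::
    "'v set \<Rightarrow> 'v set set \<Rightarrow> ('v set \<Rightarrow> real) \<Rightarrow> (real \<Rightarrow> 'v set \<Rightarrow> real) \<Rightarrow> bool" where
  "flow_solution V E \<omega>0 \<omega> \<longleftrightarrow>
     (\<forall>e\<in>E. \<omega> 0 e = \<omega>0 e) \<and>
     (\<forall>t\<ge>0. \<forall>e\<in>E. \<omega> t e > 0) \<and>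
     (\<forall>t\<ge>0. \<forall>x y. {x, y} \<in> E \<longrightarrow>
        ((\<lambda>s. \<omega> s {x, y}) has_real_derivative
           - (lly_curvature V E (\<omega> t) x y - average_curvature V E) * \<omega> t {x, y})
        (at t within {0..}))"

section \<open>Closed surfaces and polygonal tilings\<close>

definition geodesic_metric :: "'a set \<Rightarrow> ('a \<Rightarrow> 'a \<Rightarrow> real) \<Rightarrow> bool" where
  "geodesic_metric M d \<longleftrightarrow>
     (\<forall>x\<in>M. \<forall>y\<in>M. \<exists>g. g 0 = x \<and> g (d x y) = y \<and> g ` {0..d x y} \<subseteq> M \<and>
        (\<forall>s\<in>{0..d x y}. \<forall>t\<in>{0..d x y}. d (g s) (g t) = \<bar>s - t\<bar>))"

text \<open>
  A closed connected surface together with its geodesic distance \<open>d\<close>.  Only the length-space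
  structure enters, so no smoothness is required: by Hopf-Rinow the distance of every compact
  connected Riemannian surface is of this form.
\<close>

definition closed_geodesic_surface :: "'a set \<Rightarrow> ('a \<Rightarrow> 'a \<Rightarrow> real) \<Rightarrow> bool" where
  "closed_geodesic_surface M d \<longleftrightarrow>
     Metric_space M d \<and> M \<noteq> {} \<and>
     compact_space (Metric_space.mtopology M d) \<and>
     connected_space (Metric_space.mtopology M d) \<and>
     (\<forall>x\<in>M. \<exists>U. openin (Metric_space.mtopology M d) U \<and> x \<in> U \<and>
        subtopology (Metric_space.mtopology M d) U
          homeomorphic_space (euclidean :: (real^2) topology)) \<and>
     geodesic_metric M d"

text \<open>Edges and faces of a tiling are closed subsets of the surface: arcs and closed cells.\<close>

record 'a tiling =
  tverts :: "'a set"
  tarcs :: "'a set set"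
  tfaces :: "'a set set"

text \<open>An edge of the 1-skeleton is the pair of endpoints of an arc.\<close>

definition skeleton_edges :: "'a tiling \<Rightarrow> 'a set set" where
  "skeleton_edges T = (\<lambda>a. a \<inter> tverts T) ` tarcs T"

definition tiling_arc :: "'a topology \<Rightarrow> 'a tiling \<Rightarrow> 'a set \<Rightarrow> bool" where
  "tiling_arc X T a \<longleftrightarrow>
     (\<exists>g. pathin X g \<and> inj_on g {0..1} \<and> g ` {0..1} = a \<and> a \<inter> tverts T = {g 0, g 1})"

text \<open>
  The characteristic map of a face.  It is injective on the open cell only: a face may meet
  the same edge or vertex more than once along its boundary.
\<close>

definition face_map ::
    "'a topology \<Rightarrow> 'a tiling \<Rightarrow> complex set \<Rightarrow> (complex \<Rightarrow> 'a) \<Rightarrow> 'a set \<Rightarrow> bool" where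
  "face_map X T D \<phi> f \<longleftrightarrow>
     continuous_map (top_of_set D) X \<phi> \<and> \<phi> ` D = f \<and>
     inj_on \<phi> (interior D) \<and> \<phi> ` interior D \<inter> \<Union>(tarcs T) = {}"

text \<open>
  A topological \<open>k\<close>-gon, \<open>k \<ge> 3\<close>: the unit disc with its boundary circle divided into \<open>k\<close>
  sides, each of which is mapped bijectively onto an edge.
\<close>

definition polygonal_face :: "'a topology \<Rightarrow> 'a tiling \<Rightarrow> 'a set \<Rightarrow> bool" where
  "polygonal_face X T f \<longleftrightarrow>
     (\<exists>k \<phi>. 3 \<le> k \<and> face_map X T (cball 0 1) \<phi> f \<and>
        (\<forall>j<k. let side = (\<lambda>s::real. \<phi> (cis (2 * pi * (real j + s) / real k))) in
           inj_on side {0..1} \<and> side ` {0..1} \<in> tarcs T \<and>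
           side ` {0..1} \<inter> tverts T = {side 0, side 1}))"

definition polygonal_tiling :: "'a topology \<Rightarrow> 'a tiling \<Rightarrow> bool" where
  "polygonal_tiling X T \<longleftrightarrow>
     finite (tverts T) \<and> finite (tarcs T) \<and> finite (tfaces T) \<and>
     tverts T \<subseteq> \<Union>(tarcs T) \<and>
     (\<forall>a\<in>tarcs T. tiling_arc X T a) \<and>
     (\<forall>a\<in>tarcs T. \<forall>b\<in>tarcs T. a \<noteq> b \<longrightarrow> a \<inter> b \<subseteq> tverts T) \<and>
     (\<forall>f\<in>tfaces T. polygonal_face X T f) \<and>
     (\<forall>f\<in>tfaces T. \<forall>g\<in>tfaces T. f \<noteq> g \<longrightarrow> f \<inter> g \<subseteq> \<Union>(tarcs T)) \<and>
     \<Union>(tfaces T) = topspace X \<and>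
     inj_on (\<lambda>a. a \<inter> tverts T) (tarcs T) \<and>
     simple_graph (tverts T) (skeleton_edges T) \<and>
     connected_graph (tverts T) (skeleton_edges T)"

text \<open>The corners \<open>p 0, \<dots>, p (k - 1)\<close> of a Euclidean convex polygon in cyclic order.\<close>

definition convex_polygon :: "nat \<Rightarrow> (nat \<Rightarrow> complex) \<Rightarrow> bool" where
  "convex_polygon k p \<longleftrightarrow> 3 \<le> k \<and> inj_on p {..<k} \<and>
     (\<forall>j<k. closed_segment (p j) (p (Suc j mod k)) edge_of (convex hull (p ` {..<k})))"

text \<open>
  \<open>l\<close> is realised as the edge lengths of the tiling \<open>T\<close> when the surface, with the same vertices,
  edges and faces, is glued from Euclidean polygons with side lengths \<open>l\<close>.  Here \<open>\<gamma> a\<close> is an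
  arc-length parametrisation of the edge \<open>a\<close>, and every side glued to \<open>a\<close> is attached isometrically
  with respect to \<open>\<gamma> a\<close>, in one of the two directions.
\<close>

definition polygonal_partition_with_lengths ::
    "'a topology \<Rightarrow> 'a tiling \<Rightarrow> ('a set \<Rightarrow> real) \<Rightarrow> bool" where
  "polygonal_partition_with_lengths X T l \<longleftrightarrow>
     polygonal_tiling X T \<and> (\<forall>e\<in>skeleton_edges T. l e > 0) \<and>
     (\<exists>\<gamma>.
        (\<forall>a\<in>tarcs T. homeomorphic_map (top_of_set {0..l (a \<inter> tverts T)}) (subtopology X a) (\<gamma> a)) \<and>
        (\<forall>f\<in>tfaces T. \<exists>k p \<phi>.
           convex_polygon k p \<and> face_map X T (convex hull (p ` {..<k})) \<phi> f \<and>
           (\<forall>j<k. \<exists>a\<in>tarcs T.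
              let q = p (Suc j mod k); L = l (a \<inter> tverts T) in
              dist (p j) q = L \<and>
              ((\<forall>s\<in>{0..L}. \<phi> (p j + of_real (s / L) * (q - p j)) = \<gamma> a s) \<or>
               (\<forall>s\<in>{0..L}. \<phi> (p j + of_real (s / L) * (q - p j)) = \<gamma> a (L - s))))))"

end

theory Submission
  imports Defs
begin

text \<open>
  In girth at least six the graph is a tree near each edge, so an optimal transport plan between
  the two lazy measures can be written down and certified by a dual potential.  This makes the
  curvature explicit (\<open>lly_curvature_girth_gt_5\<close>).  In the coordinates \<open>u = ln \<omega>\<close> the flow becomes
  \<open>u_e' = 2 (K - \<Sum>_{x \<in> e} p_x(e))\<close> with \<open>K = |V| / |E|\<close>, where
  \<open>p_x(e) = exp u_e / \<Sum>_{f \<ni> x} exp u_f\<close> is the softmax of \<open>u\<close> over the edges at \<open>x\<close>.  This is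
  gradient ascent, at speed two, for \<open>K \<Sum>_e u_e - \<Sum>_x ln (\<Sum>_{f \<ni> x} exp u_f)\<close>, a concave function.

  Three properties of softmax carry the analysis.  It is Lipschitz on the whole space, so
  solutions exist for all time (\<open>finite_system_global_solution\<close>).  It is a monotone map, being the
  gradient of log-sum-exp, so the distance between two solutions never grows, which gives
  uniqueness.  It takes the value \<open>1 / deg x\<close> on constants, so constants are equilibria exactly when
  \<open>1 / deg x + 1 / deg y = K\<close> on every edge; this is what the two degree hypotheses provide.  The
  sum of the \<open>u_e\<close> is conserved, hence the limit must be the mean of \<open>u(0)\<close>, and the limit weight is
  the geometric mean of the initial lengths.  Convergence is exponential: the rate at which the
  distance to the mean decreases controls the distance itself, since nearly uniform softmax values
  at each vertex mean nearly equal weights at each vertex, and connectedness spreads this over the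
  whole graph (\<open>distance_le_dissipation\<close>).

  For the geometric claim, a disc with \<open>k\<close> marked sides and a regular \<open>k\<close>-gon are both cones over their
  boundary.  A characteristic map of the disc is therefore transported to the polygon by the cone
  of any boundary homeomorphism that respects sides, and this homeomorphism can be chosen to match
  a prescribed arc-length parametrisation of each edge (\<open>face_map_regular_polygon\<close>).
\<close>

section \<open>Wasserstein distance by duality\<close>

text \<open>
  The mass common to \<open>\<mu>\<close> and \<open>\<nu>\<close> stays where it is, and the two remainders, which have equal total
  \<open>R\<close>, are coupled independently.  For the lazy measures at the ends of an edge every pair in the
  supports of the remainders turns out to be transported at optimal cost, so no finer choice is
  called for.
\<close>

lemma coupling_stay_put:
  fixes \<mu> \<nu> :: "'v \<Rightarrow> real"
  assumes V: "finite V" and nonneg: "\<And>u. u \<in> V \<Longrightarrow> 0 \<le> \<mu> u \<and> 0 \<le> \<nu> u"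
    and mass: "(\<Sum>u\<in>V. \<mu> u) = (\<Sum>u\<in>V. \<nu> u)"
    and R: "R = (\<Sum>u\<in>V. \<mu> u - min (\<mu> u) (\<nu> u))" "R \<noteq> 0"
  shows "coupling V \<mu> \<nu> (\<lambda>u v. (if u = v then min (\<mu> u) (\<nu> u) else 0)
           + (\<mu> u - min (\<mu> u) (\<nu> u)) * (\<nu> v - min (\<mu> v) (\<nu> v)) / R)"
proof -
  have R': "R = (\<Sum>v\<in>V. \<nu> v - min (\<mu> v) (\<nu> v))"
    using mass R(1) by (simp add: sum_subtractf)
  have "R \<ge> 0"
    unfolding R(1) by (intro sum_nonneg) auto
  then have nn: "0 \<le> (if u = v then min (\<mu> u) (\<nu> u) else 0)
           + (\<mu> u - min (\<mu> u) (\<nu> u)) * (\<nu> v - min (\<mu> v) (\<nu> v)) / R" if "u \<in> V" "v \<in> V" for u v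
    using nonneg[OF that(1)] nonneg[OF that(2)] by (intro add_nonneg_nonneg divide_nonneg_nonneg mult_nonneg_nonneg) auto
  have row: "(\<Sum>v\<in>V. (\<mu> u - min (\<mu> u) (\<nu> u)) * (\<nu> v - min (\<mu> v) (\<nu> v)) / R) = \<mu> u - min (\<mu> u) (\<nu> u)" for u
    using R(2) R' by (simp flip: sum_divide_distrib sum_distrib_left)
  have col: "(\<Sum>u\<in>V. (\<mu> u - min (\<mu> u) (\<nu> u)) * (\<nu> v - min (\<mu> v) (\<nu> v)) / R) = \<nu> v - min (\<mu> v) (\<nu> v)" for v
    using R by (simp flip: sum_divide_distrib sum_distrib_right)
  show ?thesis
    unfolding coupling_def
  proof (intro conjI ballI)
    fix u v assume "u \<in> V" "v \<in> V"
    then show "0 \<le> (if u = v then min (\<mu> u) (\<nu> u) else 0)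
           + (\<mu> u - min (\<mu> u) (\<nu> u)) * (\<nu> v - min (\<mu> v) (\<nu> v)) / R" by (rule nn)
  qed (use V in \<open>simp_all add: sum.distrib row col sum.delta sum.delta' cong: if_cong\<close>)
qed

text \<open>
  Kantorovich duality in certificate form.  The inequality for the potential \<open>f\<close> is asked only on
  the supports of the two measures, which spares an extension of \<open>f\<close> to a Lipschitz function on
  the whole graph.
\<close>

lemma wasserstein_eqI:
  fixes f :: "'v \<Rightarrow> real"
  assumes V: "finite V" and \<pi>: "coupling V \<mu> \<nu> \<pi>"
    and lower: "\<And>u v. \<lbrakk>u \<in> V; v \<in> V; \<mu> u \<noteq> 0; \<nu> v \<noteq> 0\<rbrakk> \<Longrightarrow> f u - f v \<le> real (graph_dist E u v)"
    and upper: "\<And>u v. \<lbrakk>u \<in> V; v \<in> V; \<pi> u v \<noteq> 0\<rbrakk> \<Longrightarrow> real (graph_dist E u v) = f u - f v"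
  shows "wasserstein V E \<mu> \<nu> = (\<Sum>u\<in>V. f u * \<mu> u) - (\<Sum>v\<in>V. f v * \<nu> v)"
proof -
  have dual: "(\<Sum>u\<in>V. \<Sum>v\<in>V. (f u - f v) * \<rho> u v) = (\<Sum>u\<in>V. f u * \<mu> u) - (\<Sum>v\<in>V. f v * \<nu> v)"
    if "coupling V \<mu> \<nu> \<rho>" for \<rho>
  proof -
    have "(\<Sum>u\<in>V. \<Sum>v\<in>V. (f u - f v) * \<rho> u v)
        = (\<Sum>u\<in>V. f u * (\<Sum>v\<in>V. \<rho> u v)) - (\<Sum>u\<in>V. \<Sum>v\<in>V. f v * \<rho> u v)"
      by (simp add: left_diff_distrib sum_subtractf sum_distrib_left)
    also have "(\<Sum>u\<in>V. \<Sum>v\<in>V. f v * \<rho> u v) = (\<Sum>v\<in>V. f v * (\<Sum>u\<in>V. \<rho> u v))"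
      by (subst sum.swap) (simp add: sum_distrib_left)
    finally show ?thesis
      using that unfolding coupling_def by simp
  qed
  show ?thesis
    unfolding wasserstein_def
  proof (rule cInf_eq_minimum)
    have "(\<Sum>u\<in>V. \<Sum>v\<in>V. real (graph_dist E u v) * \<pi> u v) = (\<Sum>u\<in>V. \<Sum>v\<in>V. (f u - f v) * \<pi> u v)"
      using upper by (intro sum.cong refl) fastforce
    then show "(\<Sum>u\<in>V. f u * \<mu> u) - (\<Sum>v\<in>V. f v * \<nu> v)
        \<in> {(\<Sum>u\<in>V. \<Sum>v\<in>V. real (graph_dist E u v) * \<pi> u v) | \<pi>. coupling V \<mu> \<nu> \<pi>}"
      using \<pi> dual[OF \<pi>] by (intro CollectI exI[of _ \<pi>]) simp
  next
    fix c assume "c \<in> {(\<Sum>u\<in>V. \<Sum>v\<in>V. real (graph_dist E u v) * \<pi> u v) | \<pi>. coupling V \<mu> \<nu> \<pi>}"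
    then obtain \<rho> where c: "c = (\<Sum>u\<in>V. \<Sum>v\<in>V. real (graph_dist E u v) * \<rho> u v)"
      and \<rho>: "coupling V \<mu> \<nu> \<rho>" by blast
    have "(f u - f v) * \<rho> u v \<le> real (graph_dist E u v) * \<rho> u v" if uv: "u \<in> V" "v \<in> V" for u v
    proof (cases "\<rho> u v = 0")
      case False
      have nn: "\<forall>u\<in>V. \<forall>v\<in>V. 0 \<le> \<rho> u v" using \<rho> by (simp add: coupling_def)
      then have pos: "\<rho> u v > 0" using False uv by (simp add: less_le)
      have "\<rho> u v \<le> (\<Sum>v\<in>V. \<rho> u v)" "\<rho> u v \<le> (\<Sum>u\<in>V. \<rho> u v)"
        using nn uv V by (auto intro: member_le_sum)
      with pos \<rho> uv have "\<mu> u \<noteq> 0" "\<nu> v \<noteq> 0" by (auto simp: coupling_def)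
      then show ?thesis
        using lower[OF uv] pos by (intro mult_right_mono) auto
    qed simp
    then show "(\<Sum>u\<in>V. f u * \<mu> u) - (\<Sum>v\<in>V. f v * \<nu> v) \<le> c"
      unfolding c dual[OF \<rho>, symmetric] by (intro sum_mono) auto
  qed
qed

section \<open>Curvature of an edge in girth at least six\<close>

lemma finite_nbrs:
  assumes "simple_graph V E" shows "finite (nbrs E x)" "nbrs E x \<subseteq> V" "x \<notin> nbrs E x"
proof -
  show *: "nbrs E x \<subseteq> V" using assms by (auto simp: simple_graph_def nbrs_def)
  show "finite (nbrs E x)" using * assms finite_subset by (auto simp: simple_graph_def)
  show "x \<notin> nbrs E x" using assms by (auto simp: simple_graph_def nbrs_def)
qed

lemma edge_neq:
  assumes "simple_graph V E" "{x, y} \<in> E" shows "x \<noteq> y" "x \<in> V" "y \<in> V"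
  using assms by (auto simp: simple_graph_def)

text \<open>
  Excludes cycles of length three, four and five, which is what the next three lemmas spell out.
\<close>

lemma graph_cycle_length:
  assumes "girth E > 5" "graph_cycle E xs" shows "length xs > 5"
proof -
  have "girth E \<le> enat (length xs)"
    unfolding girth_def using assms(2) by (intro INF_lower) auto
  with assms(1) have "enat 5 < enat (length xs)"
    by (metis numeral_eq_enat order_less_le_trans)
  then show ?thesis by simp
qed

lemma graph_dist_eqI:
  assumes "(u, v) \<in> adj_rel E ^^ n" "\<And>m. m < n \<Longrightarrow> (u, v) \<notin> adj_rel E ^^ m"
  shows "graph_dist E u v = n"
  unfolding graph_dist_def using assms by (intro Least_equality) (auto simp: not_less[symmetric])

lemma no_triangle:
  assumes "simple_graph V E" "girth E > 5" "{a, b} \<in> E" "{b, c} \<in> E" shows "{a, c} \<notin> E"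
proof
  assume "{a, c} \<in> E"
  then have "graph_cycle E [a, b, c]"
    using assms edge_neq[OF assms(1)]
    by (auto simp: graph_cycle_def less_Suc_eq insert_commute)
  from graph_cycle_length[OF assms(2) this] show False by simp
qed

lemma no_square:
  assumes "simple_graph V E" "girth E > 5" "{a, b} \<in> E" "{b, c} \<in> E" "{c, d} \<in> E" "a \<noteq> c" "b \<noteq> d"
  shows "{a, d} \<notin> E"
proof
  assume "{a, d} \<in> E"
  then have "graph_cycle E [a, b, c, d]"
    using assms edge_neq[OF assms(1)]
    by (auto simp: graph_cycle_def less_Suc_eq insert_commute)
  from graph_cycle_length[OF assms(2) this] show False by simp
qed

lemma no_pentagon:
  assumes "simple_graph V E" "girth E > 5" "{a, b} \<in> E" "{b, c} \<in> E" "{c, d} \<in> E" "{d, e} \<in> E"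
    "distinct [a, b, c, d, e]"
  shows "{a, e} \<notin> E"
proof
  assume "{a, e} \<in> E"
  then have "graph_cycle E [a, b, c, d, e]"
    using assms 
    by (auto simp: graph_cycle_def less_Suc_eq insert_commute)
  from graph_cycle_length[OF assms(2) this] show False by simp
qed

text \<open>
  The dual potential for the edge \<open>xy\<close>: the signed distance from \<open>y\<close> along the tree near the edge,
  increasing from the neighbours of \<open>y\<close> through \<open>y\<close> and \<open>x\<close> to the neighbours of \<open>x\<close>.
  The value \<open>-1\<close> is meant for the neighbours of \<open>y\<close>.
\<close>

definition edge_potential :: "'v set set \<Rightarrow> 'v \<Rightarrow> 'v \<Rightarrow> 'v \<Rightarrow> real" where
  "edge_potential E x y u = (if u = x then 1 else if u = y then 0 else if u \<in> nbrs E x then 2 else -1)"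

lemma adj_rel_Suc0: "(a, b) \<in> adj_rel E ^^ Suc 0 \<longleftrightarrow> {a, b} \<in> E"
  by (simp add: adj_rel_def)

lemma adj_rel_2: "(a, b) \<in> adj_rel E ^^ Suc (Suc 0) \<longleftrightarrow> (\<exists>t. {a, t} \<in> E \<and> {t, b} \<in> E)"
  by (auto simp: adj_rel_def)

lemma adj_rel_3: "(a, b) \<in> adj_rel E ^^ Suc (Suc (Suc 0)) \<longleftrightarrow> (\<exists>s t. {a, s} \<in> E \<and> {s, t} \<in> E \<and> {t, b} \<in> E)"
  by (auto simp: adj_rel_def)

lemma graph_dist_near_edge:
  assumes G: "simple_graph V E" and g: "girth E > 5" and xy: "{x, y} \<in> E"
  shows "graph_dist E u u = 0"
    and "{a, b} \<in> E \<Longrightarrow> graph_dist E a b = 1"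
    and "\<lbrakk>{a, b} \<in> E; {b, c} \<in> E; a \<noteq> c\<rbrakk> \<Longrightarrow> graph_dist E a c = 2"
    and "\<lbrakk>{x, z} \<in> E; {y, w} \<in> E; z \<noteq> y; w \<noteq> x\<rbrakk> \<Longrightarrow> graph_dist E z w = 3"
proof -
  note neq = edge_neq[OF G]
  show "graph_dist E u u = 0" by (rule graph_dist_eqI) auto
  show "graph_dist E a b = 1" if "{a, b} \<in> E" for a b
    by (rule graph_dist_eqI) (use that neq in \<open>auto simp: adj_rel_def\<close>)
  show "graph_dist E a c = 2" if "{a, b} \<in> E" "{b, c} \<in> E" "a \<noteq> c" for a b c
  proof -
    have "{a, c} \<notin> E" using no_triangle[OF G g that(1,2)] .
    then show ?thesis
      using that by (intro graph_dist_eqI) (auto simp: numeral_2_eq_2 less_Suc_eq adj_rel_def)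
  qed
  show "graph_dist E z w = 3" if z: "{x, z} \<in> E" and w: "{y, w} \<in> E" and ne: "z \<noteq> y" "w \<noteq> x"
  proof -
    have zx: "{z, x} \<in> E" using z by (simp add: insert_commute)
    have xw: "{x, w} \<notin> E" using no_triangle[OF G g xy w] .
    have zy: "{z, y} \<notin> E" using no_triangle[OF G g zx xy] .
    have "z \<noteq> w" using z xw by auto
    moreover have "{z, w} \<notin> E" using no_square[OF G g zx xy w] ne by auto
    moreover have "\<not> (\<exists>t. {z, t} \<in> E \<and> {t, w} \<in> E)"
    proof
      assume "\<exists>t. {z, t} \<in> E \<and> {t, w} \<in> E"
      then obtain t where t: "{z, t} \<in> E" "{t, w} \<in> E" by blast
      have "distinct [z, x, y, w, t]"
        using t zx xy w ne xw zy neq[OF zx] neq[OF xy] neq[OF w] neq[OF t(1)] neq[OF t(2)] \<open>z \<noteq> w\<close> 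
        by auto
      then have "{z, t} \<notin> E"
        using no_pentagon[OF G g zx xy w] t by (auto simp: insert_commute)
      with t show False by simp
    qed
    moreover have "(z, w) \<in> adj_rel E ^^ Suc (Suc (Suc 0))"
      unfolding adj_rel_3 using zx xy w by blast
    ultimately show ?thesis
      by (intro graph_dist_eqI) (auto simp only: numeral_3_eq_3 less_Suc_eq adj_rel_2 adj_rel_Suc0 relpow.simps(1))
  qed
qed

text \<open>
  The two conditions of the duality certificate.  Equality can fail only for mass that leaves \<open>y\<close> or
  arrives at \<open>x\<close>; for large \<open>\<alpha>\<close> no such mass is left once the common mass of the two measures stays
  in place.
\<close>

lemma edge_potential_graph_dist:
  assumes G: "simple_graph V E" and g: "girth E > 5" and xy: "{x, y} \<in> E"
    and u: "u \<in> insert x (nbrs E x)" and v: "v \<in> insert y (nbrs E y)"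
  shows "edge_potential E x y u - edge_potential E x y v \<le> real (graph_dist E u v)"
    and "\<lbrakk>u \<noteq> y; v \<noteq> x\<rbrakk> \<Longrightarrow>
      real (graph_dist E u v) = edge_potential E x y u - edge_potential E x y v"
proof -
  note neq = edge_neq[OF G] 
  have yx: "{y, x} \<in> E" using xy by (simp add: insert_commute)
  note gd = graph_dist_near_edge[OF G g xy]
  have f: "edge_potential E x y v = (if v = x then 1 else if v = y then 0 else -1)"
    using v no_triangle[OF G g xy] unfolding edge_potential_def nbrs_def by auto
  have f': "edge_potential E x y u = (if u = x then 1 else if u = y then 0 else 2)"
    using u unfolding edge_potential_def by auto
  have eq: "real (graph_dist E u v) = edge_potential E x y u - edge_potential E x y v" 
    if "u \<noteq> y" "v \<noteq> x"
  proof (cases "u = x"; cases "v = y")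
    assume "u = x" "v = y"
    then show ?thesis unfolding f f' using gd(2)[OF xy] that by simp
  next
    assume *: "u = x" "v \<noteq> y"
    then have "{y, v} \<in> E" using v by (auto simp: nbrs_def)
    then show ?thesis unfolding f f' using * gd(3)[OF xy, of v] that by simp
  next
    assume *: "u \<noteq> x" "v = y"
    then have "{u, x} \<in> E" using u by (auto simp: nbrs_def insert_commute)
    then show ?thesis unfolding f f' using * gd(3)[OF _ xy, of u] that neq[OF xy] by simp
  next
    assume *: "u \<noteq> x" "v \<noteq> y"
    then have "{x, u} \<in> E" "{y, v} \<in> E" using u v by (auto simp: nbrs_def)
    then show ?thesis unfolding f f' using * gd(4)[of u v] that by simp
  qed
  then show "\<lbrakk>u \<noteq> y; v \<noteq> x\<rbrakk> \<Longrightarrow>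
      real (graph_dist E u v) = edge_potential E x y u - edge_potential E x y v" .
  show "edge_potential E x y u - edge_potential E x y v \<le> real (graph_dist E u v)"
  proof (cases "u = y \<or> v = x")
    case True
    then show ?thesis
    proof
      assume *: "u = y"
      have "graph_dist E y v = 1" if "v \<noteq> y" using gd(2)[of y v] that v by (auto simp: nbrs_def)
      then show ?thesis unfolding f f' using * neq[OF xy] by auto
    next
      assume *: "v = x"
      have "graph_dist E u x = 1" if "u \<noteq> x" using gd(2)[of u x] that u by (auto simp: nbrs_def insert_commute)
      then show ?thesis unfolding f f' using * neq[OF xy] by auto
    qed
  qed (use eq in auto)
qed

lemma lazy_measure_sum:
  fixes f :: "'v \<Rightarrow> real"
  assumes G: "simple_graph V E" and x: "x \<in> V"
  shows "(\<Sum>u\<in>V. f u * lazy_measure E \<omega> \<alpha> x u)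
       = \<alpha> * f x + (1 - \<alpha>) * (\<Sum>u\<in>nbrs E x. f u * \<omega> {x, u}) / vertex_weight E \<omega> x"
proof -
  note nb = finite_nbrs[OF G, of x]
  have "(\<Sum>u\<in>V. f u * lazy_measure E \<omega> \<alpha> x u) = (\<Sum>u\<in>insert x (nbrs E x). f u * lazy_measure E \<omega> \<alpha> x u)"
    using nb x G by (intro sum.mono_neutral_right) (auto simp: lazy_measure_def simple_graph_def)
  also have "\<dots> = f x * \<alpha> + (\<Sum>u\<in>nbrs E x. (1 - \<alpha>) * (f u * \<omega> {x, u}) / vertex_weight E \<omega> x)"
    using nb by (simp add: lazy_measure_def) (intro sum.cong, auto)
  finally show ?thesis
    by (simp add: sum_distrib_left sum_divide_distrib mult.commute)
qed

lemma vertex_weight_pos: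
  assumes G: "simple_graph V E" and pos: "\<And>e. e \<in> E \<Longrightarrow> \<omega> e > 0" and xy: "{x, y} \<in> E"
  shows "vertex_weight E \<omega> x > 0"
  unfolding vertex_weight_def using finite_nbrs[OF G] xy
  by (intro sum_pos) (auto simp: nbrs_def intro: pos)

lemma lazy_measure_neighbour_le:
  assumes G: "simple_graph V E" and pos: "\<And>e. e \<in> E \<Longrightarrow> \<omega> e > 0" and xy: "{x, y} \<in> E" and \<alpha>: "\<alpha> < 1"
  shows "lazy_measure E \<omega> \<alpha> x y \<le> 1 - \<alpha>"
proof -
  have "\<omega> {x, y} \<le> vertex_weight E \<omega> x"
    unfolding vertex_weight_def using finite_nbrs[OF G] xy
    by (intro member_le_sum[where f = "\<lambda>y. \<omega> {x, y}"]) (auto simp: nbrs_def intro: less_imp_le[OF pos])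
  then have "\<omega> {x, y} / vertex_weight E \<omega> x \<le> 1"
    using vertex_weight_pos[where \<omega> = \<omega>, OF G pos xy] by simp
  then have "(1 - \<alpha>) * (\<omega> {x, y} / vertex_weight E \<omega> x) \<le> (1 - \<alpha>) * 1"
    using \<alpha> by (intro mult_left_mono) auto
  then show ?thesis
    using edge_neq(1)[OF G xy] xy by (auto simp: lazy_measure_def nbrs_def)
qed

lemma sum_delta_weight:
  fixes w :: "'v \<Rightarrow> real"
  assumes "finite A" "a \<in> A"
  shows "(\<Sum>u\<in>A. (if u = a then c else b) * w u) = b * (\<Sum>u\<in>A. w u) + (c - b) * w a"
proof -
  have "(\<Sum>u\<in>A. (if u = a then c else b) * w u) = (\<Sum>u\<in>A. b * w u + (if u = a then (c - b) * w u else 0))"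
    by (intro sum.cong) (auto simp: algebra_simps)
  then show ?thesis
    using assms by (simp add: sum.distrib sum_distrib_left sum.delta)
qed

text \<open>
  For \<open>\<alpha> > 1 / 2\<close> the measure at \<open>x\<close> is the larger one at \<open>x\<close>, and the one at \<open>y\<close> at \<open>y\<close>.  So the
  remainders of \<open>coupling_stay_put\<close> only move mass from \<open>x\<close> and its other neighbours to \<open>y\<close> and its
  other neighbours, always along a shortest path through the edge.
\<close>

lemma wasserstein_lazy_measures:
  assumes G: "simple_graph V E" and g: "girth E > 5" and xy: "{x, y} \<in> E"
    and pos: "\<And>e. e \<in> E \<Longrightarrow> \<omega> e > 0" and \<alpha>: "1 / 2 < \<alpha>" "\<alpha> < 1"
  shows "wasserstein V E (lazy_measure E \<omega> \<alpha> x) (lazy_measure E \<omega> \<alpha> y)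
    = \<alpha> + (1 - \<alpha>) * (3 - 2 * \<omega> {x, y} * (1 / vertex_weight E \<omega> x + 1 / vertex_weight E \<omega> y))"
proof -
  have yx: "{y, x} \<in> E" using xy by (simp add: insert_commute)
  note neq = edge_neq[OF G xy]
  have V: "finite V" using G by (simp add: simple_graph_def)
  let ?f = "edge_potential E x y"
  let ?\<mu> = "lazy_measure E \<omega> \<alpha> x" and ?\<nu> = "lazy_measure E \<omega> \<alpha> y"
  define R where "R = (\<Sum>u\<in>V. ?\<mu> u - min (?\<mu> u) (?\<nu> u))"
  define \<pi> where "\<pi> u v = (if u = v then min (?\<mu> u) (?\<nu> u) else 0)
           + (?\<mu> u - min (?\<mu> u) (?\<nu> u)) * (?\<nu> v - min (?\<mu> v) (?\<nu> v)) / R" for u v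
  have mx: "vertex_weight E \<omega> x > 0" and my: "vertex_weight E \<omega> y > 0"
    using vertex_weight_pos[where \<omega> = \<omega>, OF G pos] xy yx by auto
  have nn: "0 \<le> lazy_measure E \<omega> \<alpha> z u" if "vertex_weight E \<omega> z > 0" for z u
    using \<alpha> that by (auto simp: lazy_measure_def nbrs_def intro!: divide_nonneg_pos mult_nonneg_nonneg less_imp_le[OF pos])
  have tot: "(\<Sum>u\<in>V. lazy_measure E \<omega> \<alpha> z u) = 1" if "vertex_weight E \<omega> z > 0" "z \<in> V" for z
    using lazy_measure_sum[OF G that(2), of "\<lambda>_. 1"] that by (simp add: vertex_weight_def)
  have at_y: "?\<mu> y < ?\<nu> y" and at_x: "?\<nu> x < ?\<mu> x"
    using lazy_measure_neighbour_le[where \<omega> = \<omega>, OF G pos xy \<alpha>(2)] 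
      lazy_measure_neighbour_le[where \<omega> = \<omega>, OF G pos yx \<alpha>(2)] \<alpha>
    by (auto simp: lazy_measure_def)
  have "0 < ?\<mu> x - min (?\<mu> x) (?\<nu> x)" using at_x by simp
  also have "\<dots> \<le> R" unfolding R_def using V neq by (intro member_le_sum[where f = "\<lambda>u. ?\<mu> u - min (?\<mu> u) (?\<nu> u)"]) auto
  finally have "R > 0" .
  have coup: "coupling V ?\<mu> ?\<nu> \<pi>"
    unfolding \<pi>_def using V nn[OF mx] nn[OF my] tot[OF mx] tot[OF my] neq \<open>R > 0\<close>
    by (intro coupling_stay_put) (auto simp: R_def)
  have supp: "lazy_measure E \<omega> \<alpha> z u \<noteq> 0 \<Longrightarrow> u \<in> insert z (nbrs E z)" for z u
    by (auto simp: lazy_measure_def split: if_splits)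
  have "wasserstein V E ?\<mu> ?\<nu> = (\<Sum>u\<in>V. ?f u * ?\<mu> u) - (\<Sum>v\<in>V. ?f v * ?\<nu> v)"
  proof (rule wasserstein_eqI[OF V coup])
    fix u v assume "?\<mu> u \<noteq> 0" "?\<nu> v \<noteq> 0"
    then show "?f u - ?f v \<le> real (graph_dist E u v)"
      by (intro edge_potential_graph_dist(1)[OF G g xy] supp)
  next
    fix u v assume \<pi>: "\<pi> u v \<noteq> 0"
    show "real (graph_dist E u v) = ?f u - ?f v"
    proof (cases "u = v")
      case True
      then show ?thesis using graph_dist_near_edge(1)[OF G g xy] by simp
    next
      case False
      then have lt: "?\<nu> u < ?\<mu> u" "?\<mu> v < ?\<nu> v" using \<pi> by (auto simp: \<pi>_def min_def split: if_splits)
      then have "?\<mu> u \<noteq> 0" "?\<nu> v \<noteq> 0" using nn[OF mx] nn[OF my] by (metis not_less)+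
      moreover have "u \<noteq> y" "v \<noteq> x" using lt at_x at_y by auto
      ultimately show ?thesis by (intro edge_potential_graph_dist(2)[OF G g xy] supp)
    qed
  qed
  also have "(\<Sum>u\<in>V. ?f u * ?\<mu> u) = \<alpha> + (1 - \<alpha>) * (2 * vertex_weight E \<omega> x - 2 * \<omega> {x, y}) / vertex_weight E \<omega> x"
  proof -
    have "(\<Sum>u\<in>nbrs E x. ?f u * \<omega> {x, u}) = (\<Sum>u\<in>nbrs E x. (if u = y then 0 else 2) * \<omega> {x, u})"
      using finite_nbrs(3)[OF G, of x] by (intro sum.cong) (auto simp: edge_potential_def)
    then show ?thesis
      using lazy_measure_sum[OF G neq(2), of ?f \<omega> \<alpha>] finite_nbrs[OF G, of x] xy
      by (subst (asm) sum_delta_weight) (auto simp: nbrs_def vertex_weight_def edge_potential_def)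
  qed
  also have "(\<Sum>v\<in>V. ?f v * ?\<nu> v) = (1 - \<alpha>) * (2 * \<omega> {x, y} - vertex_weight E \<omega> y) / vertex_weight E \<omega> y"
  proof -
    have "(\<Sum>u\<in>nbrs E y. ?f u * \<omega> {y, u}) = (\<Sum>u\<in>nbrs E y. (if u = x then 1 else -1) * \<omega> {y, u})"
      using finite_nbrs(3)[OF G, of y] no_triangle[OF G g xy] 
      by (intro sum.cong) (auto simp: edge_potential_def nbrs_def)
    then show ?thesis
      using lazy_measure_sum[OF G neq(3), of ?f \<omega> \<alpha>] finite_nbrs[OF G, of y] yx neq(1)
      by (subst (asm) sum_delta_weight) (auto simp: nbrs_def vertex_weight_def edge_potential_def insert_commute)
  qed
  finally show ?thesis
    using mx my by (simp add: field_simps)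
qed

text \<open>
  The quotient in the definition does not depend on \<open>\<alpha>\<close> once \<open>\<alpha> > 1 / 2\<close>, so the limit is its value.
\<close>

lemma lly_curvature_girth_gt_5:
  assumes G: "simple_graph V E" and g: "girth E > 5" and xy: "{x, y} \<in> E"
    and pos: "\<And>e. e \<in> E \<Longrightarrow> \<omega> e > 0"
  shows "lly_curvature V E \<omega> x y
    = 2 * \<omega> {x, y} * (1 / vertex_weight E \<omega> x + 1 / vertex_weight E \<omega> y) - 2"
  unfolding lly_curvature_def
proof (rule tendsto_Lim)
  have "\<forall>\<^sub>F \<alpha> in at_left (1::real). \<alpha> \<in> {1 / 2<..<1}"
    by (rule eventually_at_leftI[of "1/2"]) auto
  then have "\<forall>\<^sub>F \<alpha> in at_left 1. 2 * \<omega> {x, y} * (1 / vertex_weight E \<omega> x + 1 / vertex_weight E \<omega> y) - 2 = 1 / (1 - \<alpha>) *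
       (1 - wasserstein V E (lazy_measure E \<omega> \<alpha> x) (lazy_measure E \<omega> \<alpha> y) / real (graph_dist E x y))"
  proof eventually_elim
    case (elim \<alpha>)
    define s where "s = 2 * \<omega> {x, y} * (1 / vertex_weight E \<omega> x + 1 / vertex_weight E \<omega> y)"
    have "1 / (1 - \<alpha>) * (1 - (\<alpha> + (1 - \<alpha>) * (3 - s)) / 1) = s - 2"
      using elim by (simp add: field_simps)
    then show ?case
      using wasserstein_lazy_measures[where \<omega> = \<omega>, OF G g xy pos, of \<alpha>] elim graph_dist_near_edge(2)[OF G g xy xy]
      by (simp add: s_def)
  qed
  then show "((\<lambda>\<alpha>. 1 / (1 - \<alpha>) * (1 - wasserstein V E (lazy_measure E \<omega> \<alpha> x) (lazy_measure E \<omega> \<alpha> y)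
      / real (graph_dist E x y))) \<longlongrightarrow> 2 * \<omega> {x, y} * (1 / vertex_weight E \<omega> x + 1 / vertex_weight E \<omega> y) - 2) (at_left 1)"
    by (rule Lim_transform_eventually[OF tendsto_const])
qed simp

section \<open>Global solutions of Lipschitz differential equations\<close>

lemma indefinite_integral_has_vector_derivative_atLeast:
  fixes h :: "real \<Rightarrow> 'b::banach"
  assumes h: "continuous_on {0..} h" and t: "0 \<le> t"
  shows "((\<lambda>u. integral {0..u} h) has_vector_derivative h t) (at t within {0..})"
proof -
  have "((\<lambda>u. integral {0..u} h) has_vector_derivative h t) (at t within {0..t + 1})"
    using t by (intro integral_has_vector_derivative continuous_on_subset[OF h]) auto
  moreover have "at t within {0..t + 1} = at t within {0..}"
    using t by (intro at_within_nhd[of t "{..<t + 1}"]) auto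
  ultimately show ?thesis by simp
qed

lemma norm_integral_exp_bound:
  fixes h :: "real \<Rightarrow> 'b::banach"
  assumes h: "continuous_on {0..t} h" and b: "\<And>s. s \<in> {0..t} \<Longrightarrow> norm (h s) \<le> K * exp (l * s)"
    and t: "0 \<le> t" and K: "0 \<le> K" and l: "0 < l"
  shows "norm (integral {0..t} h) \<le> K / l * exp (l * t)"
proof -
  have int: "((\<lambda>s. K * exp (l * s)) has_integral K / l * exp (l * t) - K / l * exp (l * 0)) {0..t}"
    using t l by (intro fundamental_theorem_of_calculus)
      (auto intro!: derivative_eq_intros simp flip: has_real_derivative_iff_has_vector_derivative)
  have "norm (integral {0..t} h) \<le> integral {0..t} (\<lambda>s. K * exp (l * s))"
    using int b by (intro integral_norm_bound_integral integrable_continuous_real h) (auto intro!: continuous_intros)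
  also have "\<dots> = K / l * exp (l * t) - K / l"
    using integral_unique[OF int] by simp
  also have "\<dots> \<le> K / l * exp (l * t)"
    using K l by simp
  finally show ?thesis .
qed

text \<open>
  The Picard integral equation, solved at once on the whole half-line: in terms of \<open>v(t) = exp (- l t) u(t)\<close>, with \<open>l\<close>
  larger than the Lipschitz constant, the integral equation is a contraction of the space of bounded
  continuous functions.  Such functions live on all of \<open>\<real>\<close> here, so \<open>t\<close> is replaced by \<open>max 0 t\<close>.
\<close>

theorem lipschitz_ode_global_solution:
  fixes F :: "'b::banach \<Rightarrow> 'b"
  assumes F: "L-lipschitz_on UNIV F"
  shows "\<exists>u. u 0 = u0 \<and> (\<forall>t\<ge>0. (u has_vector_derivative F (u t)) (at t within {0..}))"
proof -
  \<comment> \<open>Any number above \<open>L\<close> makes the contraction factor \<open>L / l\<close> smaller than one.\<close>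
  define l where "l = L + 1"
  have L: "0 \<le> L" and l: "0 < l" "L / l < 1" "0 \<le> L / l"
    using lipschitz_on_nonneg[OF F] by (auto simp: l_def)
  define h where "h v s = F (exp (l * s) *\<^sub>R apply_bcontfun v s)" for v s
  define G where "G v t = exp (- (l * max 0 t)) *\<^sub>R (u0 + integral {0..max 0 t} (h v))" for v t
  have Fdist: "norm (F x - F y) \<le> L * norm (x - y)" for x y
    using F by (auto simp: lipschitz_on_def dist_norm)
  have h_cont: "continuous_on S (h v)" for v S
    unfolding h_def
    by (rule continuous_on_compose2[OF lipschitz_on_continuous_on[OF F]]) (auto intro!: continuous_intros)
  have int_deriv: "((\<lambda>u. integral {0..u} (h v)) has_vector_derivative h v t) (at t within {0..})"
    if "0 \<le> t" for v t
    by (intro indefinite_integral_has_vector_derivative_atLeast h_cont that)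
  have int_cont: "continuous_on {0..} (\<lambda>u. integral {0..u} (h v))" for v
    using int_deriv by (auto simp: continuous_on_eq_continuous_within intro: has_vector_derivative_continuous)
  have G_cont: "continuous_on UNIV (G v)" for v
    unfolding G_def
    by (intro continuous_intros continuous_on_compose2[OF int_cont]) auto
  have G_bound: "norm (G v t) \<le> norm u0 + (norm (F 0) + L * norm v) / l" for v t
  proof -
    define r where "r = max 0 t"
    have r: "0 \<le> r" by (simp add: r_def)
    have hb: "norm (h v s) \<le> (norm (F 0) + L * norm v) * exp (l * s)" if "s \<in> {0..r}" for s
    proof -
      have "norm (h v s) \<le> norm (F 0) + L * norm (exp (l * s) *\<^sub>R apply_bcontfun v s)"
        using Fdist[of "exp (l * s) *\<^sub>R apply_bcontfun v s" 0]
          norm_triangle_sub[of "h v s" "F 0"] by (simp add: h_def)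
      also have "\<dots> \<le> norm (F 0) * exp (l * s) + L * (exp (l * s) * norm v)"
        using that l(1) L norm_bounded[of v s]
        by (intro add_mono mult_left_mono) (auto intro: mult_left_mono simp: mult_le_cancel_left1)
      finally show ?thesis by (simp add: algebra_simps)
    qed
    have "norm (G v t) \<le> exp (- (l * r)) * (norm u0 + norm (integral {0..r} (h v)))"
      unfolding G_def r_def[symmetric] by (simp add: norm_triangle_ineq)
    also have "\<dots> \<le> exp (- (l * r)) * (norm u0 * exp (l * r) + (norm (F 0) + L * norm v) / l * exp (l * r))"
      using hb r l(1) L 
      by (intro mult_left_mono add_mono norm_integral_exp_bound h_cont) (auto simp: mult_le_cancel_left1)
    also have "\<dots> = norm u0 + (norm (F 0) + L * norm v) / l"
      using l(1) by (simp add: exp_minus field_simps)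
    finally show ?thesis .
  qed
  have G_in: "G v \<in> bcontfun" for v
    using G_cont G_bound by (rule bcontfun_normI)
  have "\<exists>!v. Bcontfun (G v) = v"
  proof (rule banach_fix_type[OF l(3,2)], intro allI dist_bound)
    fix v w :: "real \<Rightarrow>\<^sub>C 'b" and t :: real
    define r where "r = max 0 t"
    have r: "0 \<le> r" by (simp add: r_def)
    have "G v t - G w t = exp (- (l * r)) *\<^sub>R integral {0..r} (\<lambda>s. h v s - h w s)"
      unfolding G_def r_def[symmetric]
      by (simp add: integral_diff integrable_continuous_real h_cont algebra_simps)
    moreover have "norm (integral {0..r} (\<lambda>s. h v s - h w s)) \<le> (L * dist v w) / l * exp (l * r)"
    proof (intro norm_integral_exp_bound continuous_intros h_cont)
      fix s
      have "norm (h v s - h w s) \<le> L * norm (exp (l * s) *\<^sub>R (apply_bcontfun v s - apply_bcontfun w s))"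
        unfolding h_def scaleR_diff_right by (rule Fdist)
      also have "\<dots> \<le> L * (exp (l * s) * dist v w)"
        using L dist_bounded[of v s w] by (auto simp: dist_norm intro!: mult_left_mono)
      finally show "norm (h v s - h w s) \<le> L * dist v w * exp (l * s)" by (simp add: algebra_simps)
    qed (use L l(1) r in auto)
    ultimately have "dist (G v t) (G w t) \<le> exp (- (l * r)) * ((L * dist v w) / l * exp (l * r))"
      by (simp add: dist_norm mult_left_mono flip: times_divide_eq_right)
    also have "\<dots> = L / l * dist v w" by (simp add: exp_minus)
    finally show "dist (apply_bcontfun (Bcontfun (G v)) t) (apply_bcontfun (Bcontfun (G w)) t) \<le> L / l * dist v w"
      by (simp add: Bcontfun_inverse G_in)
  qed
  then obtain v where "Bcontfun (G v) = v" by blast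
  then have fixed: "apply_bcontfun v t = G v t" for t
    by (metis Bcontfun_inverse G_in)
  define u where "u t = u0 + integral {0..t} (h v)" for t
  have "exp (l * t) *\<^sub>R apply_bcontfun v t = u t" if "0 \<le> t" for t
    using that by (simp add: fixed G_def u_def max_def exp_minus)
  then have hu: "h v t = F (u t)" if "0 \<le> t" for t
    using that by (simp add: h_def)
  have "(u has_vector_derivative F (u t)) (at t within {0..})" if "0 \<le> t" for t
    unfolding u_def[abs_def] using int_deriv[OF that, of v] hu[OF that] 
    by (auto simp: u_def intro!: derivative_eq_intros)
  moreover have "u 0 = u0" by (simp add: u_def)
  ultimately show ?thesis by blast
qed

lemma apply_bcontfun_bounded_linear:
  "bounded_linear (\<lambda>f :: 'a::topological_space \<Rightarrow>\<^sub>C 'b::real_normed_vector. apply_bcontfun f x)"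
  by (rule bounded_linear_intro[where K = 1]) (auto simp: norm_bounded)

text \<open>
  Makes bounded continuous functions on the line a possible state space for the differential
  equation above.
\<close>

instance bcontfun :: (metric_space, banach) banach ..

text \<open>
  The finite index set \<open>I\<close> is arbitrary, so its functions are not a Banach space as a type.  They
  are embedded into the bounded continuous functions on the line, as combinations of tent functions
  centred at distinct integers; evaluation at these integers recovers the coordinates.
\<close>

theorem finite_system_global_solution:
  fixes F :: "('i \<Rightarrow> real) \<Rightarrow> 'i \<Rightarrow> real"
  assumes I: "finite I" and L: "0 \<le> L"
    and F: "\<And>a b \<delta> i. \<lbrakk>i \<in> I; \<And>j. j \<in> I \<Longrightarrow> \<bar>a j - b j\<bar> \<le> \<delta>\<rbrakk> \<Longrightarrow> \<bar>F a i - F b i\<bar> \<le> L * \<delta>"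
  shows "\<exists>u. \<forall>i\<in>I. u 0 i = u0 i \<and>
    (\<forall>t\<ge>0. ((\<lambda>t. u t i) has_real_derivative F (u t) i) (at t within {0..}))"
proof -
  obtain idx :: "'i \<Rightarrow> nat" where idx: "inj_on idx I"
    using finite_imp_inj_to_nat_seg[OF I] by blast
  define st where "st v = (\<lambda>i. apply_bcontfun v (real (idx i)))" for v :: "real \<Rightarrow>\<^sub>C real"
  define tent where "tent i x = max 0 (1 - \<bar>x - real (idx i)\<bar>)" for i x
  define emb where "emb a x = (\<Sum>i\<in>I. a i * tent i x)" for a :: "'i \<Rightarrow> real" and x
  have tent: "0 \<le> tent i x" "tent i x \<le> 1" for i x by (auto simp: tent_def)
  have emb_in: "emb a \<in> bcontfun" for a
  proof (rule bcontfun_normI)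
    show "continuous_on UNIV (emb a)"
      unfolding emb_def tent_def by (intro continuous_intros)
    show "norm (emb a x) \<le> (\<Sum>i\<in>I. \<bar>a i\<bar>)" for x
      unfolding emb_def using tent
      by (simp only: real_norm_def[symmetric]) (rule sum_norm_le, simp add: abs_mult mult_left_le)
  qed
  have emb_apply: "apply_bcontfun (Bcontfun (emb a)) = emb a" for a
    by (simp add: Bcontfun_inverse emb_in)
  have st_emb: "st (Bcontfun (emb a)) i = a i" if "i \<in> I" for a i
  proof -
    have "tent j (real (idx i)) = (if j = i then 1 else 0)" if "j \<in> I" for j
    proof -
      have "j \<noteq> i \<Longrightarrow> idx i \<noteq> idx j" using idx that \<open>i \<in> I\<close> by (auto simp: inj_on_def)
      then show ?thesis by (auto simp: tent_def)
    qed
    then have "emb a (real (idx i)) = (\<Sum>j\<in>I. if j = i then a i else 0)"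
      unfolding emb_def by (intro sum.cong) auto
    then show ?thesis using that I by (simp add: st_def emb_apply)
  qed
  define \<Phi> where "\<Phi> v = Bcontfun (emb (F (st v)))" for v
  have "(real (card I) * L)-lipschitz_on UNIV \<Phi>"
  proof (rule lipschitz_onI)
    fix v w :: "real \<Rightarrow>\<^sub>C real"
    show "dist (\<Phi> v) (\<Phi> w) \<le> real (card I) * L * dist v w"
    proof (rule dist_bound)
      fix x
      have close: "\<bar>st v j - st w j\<bar> \<le> dist v w" for j
        using dist_bounded[of v "real (idx j)" w] by (simp add: st_def dist_real_def)
      have "norm (\<Sum>i\<in>I. (F (st v) i - F (st w) i) * tent i x) \<le> (\<Sum>i\<in>I. L * dist v w)"
      proof (rule sum_norm_le)
        fix i assume "i \<in> I"
        then have "\<bar>F (st v) i - F (st w) i\<bar> \<le> L * dist v w" using close by (intro F) auto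
        then show "norm ((F (st v) i - F (st w) i) * tent i x) \<le> L * dist v w"
          using tent[of i x] mult_left_le[of "tent i x" "\<bar>F (st v) i - F (st w) i\<bar>"] by (simp add: abs_mult)
      qed
      then show "dist (apply_bcontfun (\<Phi> v) x) (apply_bcontfun (\<Phi> w) x) \<le> real (card I) * L * dist v w"
        by (simp add: \<Phi>_def emb_apply dist_real_def emb_def sum_subtractf algebra_simps)
    qed
  qed (use L in simp)
  from lipschitz_ode_global_solution[OF this, of "Bcontfun (emb u0)"] obtain v
    where v0: "v 0 = Bcontfun (emb u0)"
      and v: "\<And>t. 0 \<le> t \<Longrightarrow> (v has_vector_derivative \<Phi> (v t)) (at t within {0..})" by blast
  have "((\<lambda>t. st (v t) i) has_real_derivative F (st (v t)) i) (at t within {0..})" if "i \<in> I" "0 \<le> t" for i t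
    using bounded_linear.has_vector_derivative[OF apply_bcontfun_bounded_linear v[OF that(2)], of "real (idx i)"] 
      st_emb[OF that(1), of "F (st (v t))"]
    by (simp add: has_real_derivative_iff_has_vector_derivative st_def \<Phi>_def)
  then show ?thesis
    using v0 st_emb by (intro exI[of _ "\<lambda>t. st (v t)"]) simp
qed

lemma nonincreasing_atLeast:
  fixes f :: "real \<Rightarrow> real"
  assumes d: "\<And>t. 0 \<le> t \<Longrightarrow> (f has_real_derivative f' t) (at t within {0..})"
    and n: "\<And>t. 0 \<le> t \<Longrightarrow> f' t \<le> 0" and ab: "0 \<le> a" "a \<le> b"
  shows "f b \<le> f a"
proof (rule DERIV_nonpos_imp_decreasing_open[of a b f])
  show "a \<le> b" by (rule ab(2))
  fix t :: real assume "a < t" "t < b"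
  then have "t > 0" using ab by simp
  then have "at t within {0..} = at t" by (intro at_within_interior) simp
  then show "\<exists>y. (f has_real_derivative y) (at t) \<and> y \<le> 0"
    using d[of t] n[of t] \<open>t > 0\<close> by auto
next
  have "continuous_on {0..} f"
    using d by (intro DERIV_continuous_on) auto
  then show "continuous_on {a..b} f"
    by (rule continuous_on_subset) (use ab in auto)
qed

section \<open>The softmax map\<close>

definition softmax :: "'i set \<Rightarrow> ('i \<Rightarrow> real) \<Rightarrow> 'i \<Rightarrow> real" where
  "softmax A u i = exp (u i) / (\<Sum>j\<in>A. exp (u j))"

lemma softmax_denominator_pos:
  assumes "finite A" "i \<in> A" shows "0 < (\<Sum>j\<in>A. exp (u j :: real))"
  using assms by (intro sum_pos) auto

lemma softmax_pos: "\<lbrakk>finite A; i \<in> A\<rbrakk> \<Longrightarrow> 0 < softmax A u i"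
  unfolding softmax_def by (intro divide_pos_pos softmax_denominator_pos) auto

lemma sum_softmax: "\<lbrakk>finite A; A \<noteq> {}\<rbrakk> \<Longrightarrow> (\<Sum>i\<in>A. softmax A u i) = 1"
  using softmax_denominator_pos[of A _ u] by (auto simp: softmax_def simp flip: sum_divide_distrib)

lemma softmax_le_1:
  assumes "finite A" "i \<in> A" shows "softmax A u i \<le> 1"
proof -
  have "softmax A u i \<le> (\<Sum>j\<in>A. softmax A u j)"
    using assms by (intro member_le_sum less_imp_le[OF softmax_pos]) auto
  then show ?thesis using sum_softmax[of A u] assms by (cases "A = {}") auto
qed

lemma softmax_const: "\<lbrakk>finite A; i \<in> A\<rbrakk> \<Longrightarrow> softmax A (\<lambda>_. c) i = 1 / real (card A)"
  by (simp add: softmax_def)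

lemma ln_softmax: "\<lbrakk>finite A; i \<in> A\<rbrakk> \<Longrightarrow> ln (softmax A u i) = u i - ln (\<Sum>j\<in>A. exp (u j))"
  unfolding softmax_def using softmax_denominator_pos[of A i u] by (simp add: ln_div)

lemma softmax_ge_exp_mult:
  assumes A: "finite A" "i \<in> A" and close: "\<And>j. j \<in> A \<Longrightarrow> \<bar>u j - v j\<bar> \<le> \<delta>"
  shows "exp (- (2 * \<delta>)) * softmax A v i \<le> softmax A u i"
proof -
  have "(\<Sum>j\<in>A. exp (u j)) \<le> (\<Sum>j\<in>A. exp \<delta> * exp (v j))"
  proof (rule sum_mono)
    fix j assume "j \<in> A"
    from close[OF this] show "exp (u j) \<le> exp \<delta> * exp (v j)" by (simp flip: exp_add)
  qed
  then have den: "(\<Sum>j\<in>A. exp (u j)) \<le> exp \<delta> * (\<Sum>j\<in>A. exp (v j))" by (simp add: sum_distrib_left)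
  have num: "exp (v i - \<delta>) \<le> exp (u i)" using close[OF A(2)] by simp
  have e2: "exp (- (2 * \<delta>)) = 1 / (exp \<delta> * exp \<delta>)"
    by (simp add: exp_minus divide_inverse flip: exp_add)
  have "exp (- (2 * \<delta>)) * softmax A v i = exp (v i - \<delta>) / (exp \<delta> * (\<Sum>j\<in>A. exp (v j)))"
    unfolding softmax_def e2 exp_diff by simp
  also have "\<dots> \<le> exp (u i) / (\<Sum>j\<in>A. exp (u j))"
    using num den softmax_denominator_pos[OF A, of u] by (intro frac_le) auto
  finally show ?thesis by (simp add: softmax_def)
qed

text \<open>
  A change of \<open>u\<close> by at most \<open>\<delta>\<close> changes each softmax value by a factor of at least \<open>exp (- 2 \<delta>)\<close>.  Since
  the values are at most one and \<open>1 - exp (- 2 \<delta>) \<le> 2 \<delta>\<close>, this is a bound for the difference.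
\<close>

lemma softmax_lipschitz:
  assumes A: "finite A" "i \<in> A" and close: "\<And>j. j \<in> A \<Longrightarrow> \<bar>u j - v j\<bar> \<le> \<delta>"
  shows "\<bar>softmax A u i - softmax A v i\<bar> \<le> 2 * \<delta>"
proof -
  have "q - p \<le> 2 * \<delta>" if "exp (- (2 * \<delta>)) * q \<le> p" "0 \<le> q" "q \<le> 1" for p q :: real
  proof -
    have "(1 - 2 * \<delta>) * q \<le> exp (- (2 * \<delta>)) * q"
      using exp_ge_add_one_self[of "- (2 * \<delta>)"] that by (intro mult_right_mono) auto
    then have "q - p \<le> 2 * \<delta> * q" using that by (simp add: algebra_simps)
    also have "\<dots> \<le> 2 * \<delta>" using close[OF A(2)] that by (simp add: mult_left_le)
    finally show ?thesis .
  qed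
  from this[OF softmax_ge_exp_mult[OF A, of u v \<delta>]] this[OF softmax_ge_exp_mult[OF A, of v u \<delta>]]
  show ?thesis
    using close softmax_pos[OF A, of u] softmax_pos[OF A, of v] softmax_le_1[OF A, of u] softmax_le_1[OF A, of v]
    by (auto simp: abs_minus_commute abs_le_iff less_imp_le)
qed

lemma diff_squared_le_ln_diff:
  fixes p q :: real
  assumes "0 < p" "p \<le> 1" "0 < q" "q \<le> 1"
  shows "(p - q)\<^sup>2 \<le> (ln p - ln q) * (p - q)"
proof -
  have *: "p - q \<le> ln p - ln q" if "q \<le> p" "0 < q" "p \<le> 1" for p q :: real
  proof -
    have "ln q - ln p \<le> q / p - 1"
      using ln_le_minus_one[of "q / p"] that by (simp add: ln_div)
    moreover have "p - q \<le> (p - q) / p"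
      using that by (simp add: pos_le_divide_eq mult_left_le)
    ultimately show ?thesis using that by (simp add: diff_divide_distrib)
  qed
  show ?thesis
  proof (cases "q \<le> p")
    case True
    then show ?thesis using *[of q p] assms by (auto simp: power2_eq_square intro!: mult_right_mono)
  next
    case False
    then have "(q - p) * (q - p) \<le> (ln q - ln p) * (q - p)"
      using *[of p q] assms by (intro mult_right_mono) auto
    then show ?thesis by (simp add: power2_eq_square algebra_simps)
  qed
qed

text \<open>
  Up to a constant \<open>k\<close>, which is annihilated because the softmax values have sum one, \<open>u i - v i\<close> is the
  difference of the logarithms of the softmax values; and the logarithm is increasing with slope at
  least one on the unit interval.
\<close>

lemma softmax_monotone:
  assumes A: "finite A"
  shows "(\<Sum>i\<in>A. (softmax A u i - softmax A v i)\<^sup>2)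
     \<le> (\<Sum>i\<in>A. (u i - v i) * (softmax A u i - softmax A v i))"
proof (cases "A = {}")
  case False
  let ?d = "\<lambda>i. softmax A u i - softmax A v i"
  \<comment> \<open>The difference of the two normalising constants, independent of \<open>i\<close>.\<close>
  define k where "k = ln (\<Sum>j\<in>A. exp (u j)) - ln (\<Sum>j\<in>A. exp (v j))"
  have "(\<Sum>i\<in>A. (?d i)\<^sup>2) \<le> (\<Sum>i\<in>A. (ln (softmax A u i) - ln (softmax A v i)) * ?d i)"
    using softmax_pos[OF A] softmax_le_1[OF A] by (intro sum_mono diff_squared_le_ln_diff) auto
  also have "\<dots> = (\<Sum>i\<in>A. (u i - v i) * ?d i - k * ?d i)"
    by (intro sum.cong) (simp_all add: ln_softmax A k_def algebra_simps)
  also have "\<dots> = (\<Sum>i\<in>A. (u i - v i) * ?d i) - k * (\<Sum>i\<in>A. ?d i)"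
    by (simp only: sum_subtractf[of "\<lambda>i. (u i - v i) * ?d i"] sum_distrib_left)
  also have "(\<Sum>i\<in>A. ?d i) = 0"
    using sum_softmax[OF A False] by (simp add: sum_subtractf)
  finally show ?thesis by simp
qed simp

lemma abs_ln_diff_le:
  fixes p q s :: real
  assumes "0 < s" "s \<le> p" "s \<le> q"
  shows "\<bar>ln p - ln q\<bar> \<le> \<bar>p - q\<bar> / s"
proof -
  have *: "ln p - ln q \<le> \<bar>p - q\<bar> / s" if "s \<le> p" "s \<le> q" for p q
  proof -
    have "ln p - ln q \<le> p / q - 1"
      using ln_le_minus_one[of "p / q"] that assms(1) by (simp add: ln_div)
    also have "\<dots> = (p - q) / q" using that assms(1) by (simp add: diff_divide_distrib)
    also have "\<dots> \<le> \<bar>p - q\<bar> / s" using that assms(1) by (intro frac_le) auto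
    finally show ?thesis .
  qed
  show ?thesis using *[of p q] *[of q p] assms by (simp add: abs_minus_commute abs_le_iff)
qed

section \<open>The flow in logarithmic coordinates\<close>

definition incident :: "'v set set \<Rightarrow> 'v \<Rightarrow> 'v set set" where
  "incident E x = {e \<in> E. x \<in> e}"

lemma finite_edges: "simple_graph V E \<Longrightarrow> finite E"
  unfolding simple_graph_def by (rule finite_subset[of E "Pow V"]) auto

lemma finite_incident: "simple_graph V E \<Longrightarrow> finite (incident E x)"
  unfolding incident_def by (simp add: finite_edges)

lemma sum_edges_vertices:
  fixes h :: "'v \<Rightarrow> 'v set \<Rightarrow> real"
  assumes G: "simple_graph V E"
  shows "(\<Sum>e\<in>E. \<Sum>x\<in>e. h x e) = (\<Sum>x\<in>V. \<Sum>e\<in>incident E x. h x e)"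
proof -
  have "(\<Sum>e\<in>E. \<Sum>x\<in>e. h x e) = (\<Sum>e\<in>E. \<Sum>x\<in>{x. x \<in> V \<and> x \<in> e}. h x e)"
    using G by (intro sum.cong) (auto simp: simple_graph_def)
  also have "\<dots> = (\<Sum>x\<in>V. \<Sum>e\<in>{e. e \<in> E \<and> x \<in> e}. h x e)"
    using G finite_edges by (intro sum.swap_restrict) (auto simp: simple_graph_def)
  finally show ?thesis by (simp add: incident_def)
qed

text \<open>
  The equation of the flow for the logarithms of the weights.  The constant \<open>K\<close> is kept general
  until the value \<open>|V| / |E|\<close> matters.
\<close>

definition log_flow :: "'v set set \<Rightarrow> real \<Rightarrow> (real \<Rightarrow> 'v set \<Rightarrow> real) \<Rightarrow> bool" where
  "log_flow E K u \<longleftrightarrow> (\<forall>t\<ge>0. \<forall>e\<in>E. ((\<lambda>s. u s e) has_real_derivative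
      2 * (K - (\<Sum>x\<in>e. softmax (incident E x) (u t) e))) (at t within {0..}))"

text \<open>
  Each edge has two ends, and each of them contributes a Lipschitz constant of two, which the factor
  two in the equation doubles.
\<close>

lemma log_flow_exists:
  fixes E :: "'v set set"
  assumes G: "simple_graph V E"
  shows "\<exists>u. log_flow E K u \<and> (\<forall>e\<in>E. u 0 e = u0 e)"
proof -
  have "\<exists>u. \<forall>e\<in>E. u 0 e = u0 e \<and> (\<forall>t\<ge>0. ((\<lambda>t. u t e) has_real_derivative
      2 * (K - (\<Sum>x\<in>e. softmax (incident E x) (u t) e))) (at t within {0..}))"
  proof (rule finite_system_global_solution[where L = 8 and F = "\<lambda>u e. 2 * (K - (\<Sum>x\<in>e. softmax (incident E x) u e))"])
    fix u v :: "'v set \<Rightarrow> real" and \<delta> and e :: "'v set" assume e: "e \<in> E" and close: "\<And>j. j \<in> E \<Longrightarrow> \<bar>u j - v j\<bar> \<le> \<delta>"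
    have "norm (\<Sum>x\<in>e. softmax (incident E x) v e - softmax (incident E x) u e) \<le> (\<Sum>x\<in>e. 2 * \<delta>)"
      using e close finite_incident[OF G]
      by (intro sum_norm_le) (auto intro!: softmax_lipschitz simp: incident_def abs_minus_commute)
    also have "\<dots> = 4 * \<delta>" using G e by (auto simp: simple_graph_def)
    finally show "\<bar>2 * (K - (\<Sum>x\<in>e. softmax (incident E x) u e)) - 2 * (K - (\<Sum>x\<in>e. softmax (incident E x) v e))\<bar>
        \<le> 8 * \<delta>"
      by (simp add: sum_subtractf)
  qed (use finite_edges[OF G] in auto)
  then show ?thesis unfolding log_flow_def by blast
qed

lemma log_flow_distance_derivative:
  assumes G: "simple_graph V E" and u: "log_flow E K u" and v: "log_flow E K v" and t: "0 \<le> t"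
  shows "((\<lambda>t. \<Sum>e\<in>E. (u t e - v t e)\<^sup>2) has_real_derivative
      - 4 * (\<Sum>x\<in>V. \<Sum>e\<in>incident E x. (u t e - v t e) *
        (softmax (incident E x) (u t) e - softmax (incident E x) (v t) e))) (at t within {0..})"
proof -
  let ?s = "\<lambda>w x e. softmax (incident E x) (w t) e"
  have deriv: "((\<lambda>t. (u t e - v t e)\<^sup>2) has_real_derivative
      - 4 * (\<Sum>x\<in>e. (u t e - v t e) * (?s u x e - ?s v x e))) (at t within {0..})" if "e \<in> E" for e
  proof -
    have "((\<lambda>t. u t e - v t e) has_real_derivative
        2 * (K - (\<Sum>x\<in>e. ?s u x e)) - 2 * (K - (\<Sum>x\<in>e. ?s v x e))) (at t within {0..})"
      using u v t that unfolding log_flow_def by (intro DERIV_diff) auto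
    from DERIV_power[OF this, of 2] show ?thesis
      unfolding sum_distrib_left[symmetric] sum_subtractf by (rule DERIV_cong) (simp add: algebra_simps)
  qed
  have "((\<lambda>t. \<Sum>e\<in>E. (u t e - v t e)\<^sup>2) has_real_derivative
      (\<Sum>e\<in>E. - 4 * (\<Sum>x\<in>e. (u t e - v t e) * (?s u x e - ?s v x e)))) (at t within {0..})"
    by (intro DERIV_sum deriv)
  also have "(\<Sum>e\<in>E. - 4 * (\<Sum>x\<in>e. (u t e - v t e) * (?s u x e - ?s v x e)))
      = - 4 * (\<Sum>e\<in>E. \<Sum>x\<in>e. (u t e - v t e) * (?s u x e - ?s v x e))"
    by (rule sum_distrib_left[symmetric])
  also note sum_edges_vertices[OF G]
  finally show ?thesis .
qed

text \<open>
  The squared distance between two solutions decreases at least as fast as their softmax values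
  differ.  Monotonicity holds at each vertex separately, after the sum over edges has been
  regrouped by vertices.
\<close>

lemma log_flow_distance_dissipation:
  assumes G: "simple_graph V E"
  shows "- 4 * (\<Sum>x\<in>V. \<Sum>e\<in>incident E x. (u e - v e) *
        (softmax (incident E x) u e - softmax (incident E x) v e))
    \<le> - 4 * (\<Sum>x\<in>V. \<Sum>e\<in>incident E x. (softmax (incident E x) u e - softmax (incident E x) v e)\<^sup>2)"
proof -
  have "(\<Sum>x\<in>V. \<Sum>e\<in>incident E x. (softmax (incident E x) u e - softmax (incident E x) v e)\<^sup>2)
    \<le> (\<Sum>x\<in>V. \<Sum>e\<in>incident E x. (u e - v e) * (softmax (incident E x) u e - softmax (incident E x) v e))"
    by (intro sum_mono softmax_monotone finite_incident[OF G])
  then show ?thesis by simp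
qed

lemma log_flow_distance_nonincreasing:
  assumes G: "simple_graph V E" and u: "log_flow E K u" and v: "log_flow E K v" and t: "0 \<le> t"
  shows "(\<Sum>e\<in>E. (u t e - v t e)\<^sup>2) \<le> (\<Sum>e\<in>E. (u 0 e - v 0 e)\<^sup>2)"
  by (rule nonincreasing_atLeast[OF log_flow_distance_derivative[OF G u v]
        order_trans[OF log_flow_distance_dissipation[OF G]]])
    (use t in \<open>auto intro!: sum_nonneg\<close>)

lemma log_flow_unique:
  assumes G: "simple_graph V E" and u: "log_flow E K u" and v: "log_flow E K v"
    and init: "\<And>e. e \<in> E \<Longrightarrow> u 0 e = v 0 e" and t: "0 \<le> t" and e: "e \<in> E"
  shows "u t e = v t e"
proof -
  have "(\<Sum>e\<in>E. (u t e - v t e)\<^sup>2) \<le> 0"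
    using log_flow_distance_nonincreasing[OF G u v t] init by simp
  then have "(\<Sum>e\<in>E. (u t e - v t e)\<^sup>2) = 0"
    by (intro antisym sum_nonneg) auto
  then show ?thesis
    using e finite_edges[OF G] by (simp add: sum_nonneg_eq_0_iff)
qed

text \<open>
  A walk of length \<open>n\<close> from an end of \<open>e\<close> to an end of \<open>f\<close> compares the two edges in \<open>n + 1\<close> steps, each
  at a single vertex.  The constant is the sum of such lengths over all pairs of vertices.
\<close>

lemma edge_chain_bound:
  assumes G: "simple_graph V E" and conn: "connected_graph V E"
  shows "\<exists>N\<ge>0. \<forall>u b. 0 \<le> b \<longrightarrow>
    (\<forall>x\<in>V. \<forall>e\<in>incident E x. \<forall>f\<in>incident E x. \<bar>u e - u f\<bar> \<le> b) \<longrightarrow>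
    (\<forall>e\<in>E. \<forall>f\<in>E. \<bar>u e - u f\<bar> \<le> N * (b :: real))"
proof -
  let ?loc = "\<lambda>u b. 0 \<le> b \<and> (\<forall>x\<in>V. \<forall>e\<in>incident E x. \<forall>f\<in>incident E x. \<bar>u e - u f\<bar> \<le> b)"
  have walk: "\<forall>e\<in>incident E x. \<forall>f\<in>incident E y. \<bar>u e - u f\<bar> \<le> (real n + 1) * b"
    if "?loc u b" "(x, y) \<in> adj_rel E ^^ n" "x \<in> V" for u b x y n
    using that(2)
  proof (induction n arbitrary: y)
    case 0
    then show ?case using that by simp
  next
    case (Suc n)
    then obtain z where z: "(x, z) \<in> adj_rel E ^^ n" "{z, y} \<in> E" by (auto simp: adj_rel_def)
    have "y \<in> V" and inc: "{z, y} \<in> incident E z" "{z, y} \<in> incident E y"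
      using z edge_neq[OF G] by (auto simp: incident_def)
    show ?case
    proof (intro ballI)
      fix e f assume ef: "e \<in> incident E x" "f \<in> incident E y"
      have "\<bar>u e - u {z, y}\<bar> \<le> (real n + 1) * b" using Suc.IH[OF z(1)] ef inc by blast
      moreover have "\<bar>u {z, y} - u f\<bar> \<le> b" using that(1) ef inc \<open>y \<in> V\<close> by blast
      ultimately show "\<bar>u e - u f\<bar> \<le> (real (Suc n) + 1) * b" by (simp add: algebra_simps)
    qed
  qed
  have fin: "finite (V \<times> V)" using G by (simp add: simple_graph_def)
  have "\<forall>p\<in>V \<times> V. \<exists>n. p \<in> adj_rel E ^^ n"
    using conn by (auto simp: connected_graph_def rtrancl_power)
  then obtain n where n: "\<And>p. p \<in> V \<times> V \<Longrightarrow> p \<in> adj_rel E ^^ n p" by metis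
  \<comment> \<open>The sum stands in for the maximum of the walk lengths; the summand one is for the last step.\<close>
  define N where "N = (\<Sum>p\<in>V \<times> V. real (n p)) + 1"
  have "\<bar>u e - u f\<bar> \<le> N * b" if loc: "?loc u b" and "e \<in> E" "f \<in> E" for u b e f
  proof -
    obtain x y where x: "x \<in> e" "x \<in> V" and y: "y \<in> f" "y \<in> V"
      using G \<open>e \<in> E\<close> \<open>f \<in> E\<close> unfolding simple_graph_def
      by (metis (no_types, lifting) card_2_iff insertI1 subsetD)
    then have "\<bar>u e - u f\<bar> \<le> (real (n (x, y)) + 1) * b"
      using walk[OF loc n[of "(x, y)"]] that by (auto simp: incident_def)
    also have "real (n (x, y)) \<le> (\<Sum>p\<in>V \<times> V. real (n p))"
      using fin x y by (intro member_le_sum) auto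
    then have "(real (n (x, y)) + 1) * b \<le> N * b"
      using loc unfolding N_def by (intro mult_right_mono) auto
    finally show ?thesis .
  qed
  moreover have "N \<ge> 0" unfolding N_def by (intro add_nonneg_nonneg sum_nonneg) auto
  ultimately show ?thesis by (intro exI[of _ N]) auto
qed

lemma log_flow_constant:
  assumes G: "simple_graph V E" and K: "\<And>e. e \<in> E \<Longrightarrow> (\<Sum>x\<in>e. 1 / real (card (incident E x))) = K"
  shows "log_flow E K (\<lambda>_ _. c)"
  unfolding log_flow_def
proof (intro allI impI ballI)
  fix t :: real and e assume e: "e \<in> E"
  have "(\<Sum>x\<in>e. softmax (incident E x) (\<lambda>_. c) e) = (\<Sum>x\<in>e. 1 / real (card (incident E x)))"
    using e by (intro sum.cong softmax_const finite_incident[OF G] refl) (auto simp: incident_def)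
  then show "((\<lambda>s. c) has_real_derivative 2 * (K - (\<Sum>x\<in>e. softmax (incident E x) (\<lambda>_. c) e))) (at t within {0..})"
    using K[OF e] by simp
qed

lemma sum_reciprocal_degrees:
  assumes G: "simple_graph V E" and no_isolated: "\<And>x. x \<in> V \<Longrightarrow> incident E x \<noteq> {}"
  shows "(\<Sum>e\<in>E. \<Sum>x\<in>e. 1 / real (card (incident E x))) = real (card V)"
proof -
  have "(\<Sum>e\<in>E. \<Sum>x\<in>e. 1 / real (card (incident E x))) = (\<Sum>x\<in>V. \<Sum>e\<in>incident E x. 1 / real (card (incident E x)))"
    by (rule sum_edges_vertices[OF G])
  also have "\<dots> = (\<Sum>x\<in>V. 1)"
    using no_isolated finite_incident[OF G] by (intro sum.cong) auto
  finally show ?thesis by simp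
qed

text \<open>
  The softmax values at one vertex have sum one, so the total of the derivatives is
  \<open>2 (K |E| - |V|)\<close>; the degree condition makes this vanish.
\<close>

lemma log_flow_sum_conserved:
  assumes G: "simple_graph V E" and no_isolated: "\<And>x. x \<in> V \<Longrightarrow> incident E x \<noteq> {}"
    and K: "\<And>e. e \<in> E \<Longrightarrow> (\<Sum>x\<in>e. 1 / real (card (incident E x))) = K"
    and u: "log_flow E K u" and t: "0 \<le> t"
  shows "(\<Sum>e\<in>E. u t e) = (\<Sum>e\<in>E. u 0 e)"
proof -
  have K_total: "K * real (card E) = real (card V)"
    using sum_reciprocal_degrees[OF G no_isolated] K by (simp add: mult.commute)
  have deriv: "((\<lambda>t. \<Sum>e\<in>E. u t e) has_real_derivative 0) (at t within {0..})" if "0 \<le> t" for t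
  proof -
    have "((\<lambda>t. \<Sum>e\<in>E. u t e) has_real_derivative
        (\<Sum>e\<in>E. 2 * (K - (\<Sum>x\<in>e. softmax (incident E x) (u t) e)))) (at t within {0..})"
      using u that unfolding log_flow_def by (intro DERIV_sum) auto
    also have "(\<Sum>e\<in>E. 2 * (K - (\<Sum>x\<in>e. softmax (incident E x) (u t) e)))
        = 2 * (K * real (card E) - (\<Sum>x\<in>V. \<Sum>e\<in>incident E x. softmax (incident E x) (u t) e))"
      by (simp add: sum_subtractf sum_edges_vertices[OF G] flip: sum_distrib_left)
    also have "(\<Sum>x\<in>V. \<Sum>e\<in>incident E x. softmax (incident E x) (u t) e) = (\<Sum>x\<in>V. 1)"
      using no_isolated by (intro sum.cong sum_softmax finite_incident[OF G]) auto
    finally show ?thesis using K_total by simp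
  qed
  have "(\<Sum>e\<in>E. u t e) \<le> (\<Sum>e\<in>E. u 0 e)"
    by (rule nonincreasing_atLeast[OF deriv]) (use t in auto)
  moreover have "- (\<Sum>e\<in>E. u t e) \<le> - (\<Sum>e\<in>E. u 0 e)"
    by (rule nonincreasing_atLeast[OF DERIV_minus[OF deriv]]) (use t in auto)
  ultimately show ?thesis by simp
qed

lemma abs_diff_mean_le:
  fixes u :: "'i \<Rightarrow> real"
  assumes "finite A" "i \<in> A" and close: "\<And>j. j \<in> A \<Longrightarrow> \<bar>u i - u j\<bar> \<le> b"
  shows "\<bar>u i - (\<Sum>j\<in>A. u j) / real (card A)\<bar> \<le> b"
proof -
  have card: "real (card A) > 0" using assms by (auto simp: card_gt_0_iff)
  have "norm (\<Sum>j\<in>A. u i - u j) \<le> (\<Sum>j\<in>A. b)"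
    using close by (intro sum_norm_le) auto
  also have "(\<Sum>j\<in>A. u i - u j) = real (card A) * (u i - (\<Sum>j\<in>A. u j) / real (card A))"
    using card by (simp add: sum_subtractf right_diff_distrib)
  finally show ?thesis using card by (simp add: abs_mult)
qed

text \<open>
  The Poincare inequality behind exponential convergence.  The bound \<open>r\<close> on \<open>u - c\<close> keeps all
  softmax values at least \<open>s\<close>, where the logarithm is Lipschitz.  Hence the dissipation bounds the oscillation
  of \<open>u\<close> at each vertex, by \<open>edge_chain_bound\<close> the oscillation over all edges, and so the distance to
  the mean.
\<close>

lemma distance_le_dissipation:
  assumes G: "simple_graph V E" and conn: "connected_graph V E" and r: "0 \<le> r"
  shows "\<exists>M\<ge>0. \<forall>u c. (\<Sum>e\<in>E. u e) = real (card E) * c \<longrightarrow> (\<forall>e\<in>E. \<bar>u e - c\<bar> \<le> r) \<longrightarrow>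
    (\<Sum>e\<in>E. (u e - c)\<^sup>2) \<le>
      M * (\<Sum>x\<in>V. \<Sum>e\<in>incident E x. (softmax (incident E x) u e - softmax (incident E x) (\<lambda>_. c) e)\<^sup>2)"
proof (cases "E = {}")
  case False
  have finE: "finite E" and finV: "finite V" using finite_edges[OF G] G by (auto simp: simple_graph_def)
  have cardE: "real (card E) > 0" using False finE by (auto simp: card_gt_0_iff)
  obtain N where N: "N \<ge> 0" and chain: "\<forall>u b. 0 \<le> b \<longrightarrow>
    (\<forall>x\<in>V. \<forall>e\<in>incident E x. \<forall>f\<in>incident E x. \<bar>u e - u f\<bar> \<le> b) \<longrightarrow>
    (\<forall>e\<in>E. \<forall>f\<in>E. \<bar>u e - u f\<bar> \<le> N * (b :: real))"
    using edge_chain_bound[OF G conn] by (elim exE conjE)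
  \<comment> \<open>Values \<open>1 / deg x \<ge> 1 / |E|\<close> of a constant, reduced by the factor for a change of at most \<open>r\<close>.\<close>
  define s where "s = exp (- (2 * r)) / real (card E)"
  have s: "0 < s" using cardE by (simp add: s_def)
  \<comment> \<open>Each of the two edges compared at a vertex costs \<open>sqrt Q / s\<close>, and a chain has at most \<open>N\<close> steps.\<close>
  define M where "M = real (card E) * (N * (2 / s))\<^sup>2"
  have "(\<Sum>e\<in>E. (u e - c)\<^sup>2) \<le> M * Q"
    if mean: "(\<Sum>e\<in>E. u e) = real (card E) * c" and close: "\<forall>e\<in>E. \<bar>u e - c\<bar> \<le> r"
      and Q: "Q = (\<Sum>x\<in>V. \<Sum>e\<in>incident E x. (softmax (incident E x) u e - softmax (incident E x) (\<lambda>_. c) e)\<^sup>2)"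
    for u c Q
  proof -
    have Q0: "0 \<le> Q" unfolding Q by (intro sum_nonneg) auto
    have local: "\<bar>u e - u f\<bar> \<le> 2 / s * sqrt Q" if x: "x \<in> V" and ef: "e \<in> incident E x" "f \<in> incident E x" for x e f
    proof -
      let ?A = "incident E x"
      have finA: "finite ?A" by (rule finite_incident[OF G])
      have cardA: "0 < card ?A" "card ?A \<le> card E"
        using ef finA finE by (auto simp: card_gt_0_iff incident_def intro: card_mono)
      have bound: "\<bar>ln (softmax ?A u g) - ln (softmax ?A (\<lambda>_. c) g)\<bar> \<le> sqrt Q / s" if g: "g \<in> ?A" for g
      proof -
        have "exp (- (2 * r)) \<le> 1" using r by simp
        have sc1: "s \<le> exp (- (2 * r)) * softmax ?A (\<lambda>_. c) g"
          using cardA unfolding s_def softmax_const[OF finA g] by (simp add: frac_le)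
        also have "\<dots> \<le> softmax ?A (\<lambda>_. c) g"
          using \<open>exp (- (2 * r)) \<le> 1\<close> softmax_pos[OF finA g] by (simp add: mult_left_le_one_le less_imp_le)
        finally have sc2: "s \<le> softmax ?A (\<lambda>_. c) g" .
        have "exp (- (2 * r)) * softmax ?A (\<lambda>_. c) g \<le> softmax ?A u g"
          using close by (intro softmax_ge_exp_mult[OF finA g]) (auto simp: incident_def)
        then have su: "s \<le> softmax ?A u g" using sc1 by simp
        have "(softmax ?A u g - softmax ?A (\<lambda>_. c) g)\<^sup>2 \<le> (\<Sum>e\<in>?A. (softmax ?A u e - softmax ?A (\<lambda>_. c) e)\<^sup>2)"
          using finA g by (intro member_le_sum) auto
        also have "\<dots> \<le> Q"
          unfolding Q using finV x
          by (intro member_le_sum[where f = "\<lambda>x. \<Sum>e\<in>incident E x. (softmax (incident E x) u e - softmax (incident E x) (\<lambda>_. c) e)\<^sup>2"])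
            (auto intro: sum_nonneg)
        finally have "\<bar>softmax ?A u g - softmax ?A (\<lambda>_. c) g\<bar> \<le> sqrt Q"
          using real_le_rsqrt[of "\<bar>softmax ?A u g - softmax ?A (\<lambda>_. c) g\<bar>" Q] by simp
        then have "\<bar>softmax ?A u g - softmax ?A (\<lambda>_. c) g\<bar> / s \<le> sqrt Q / s"
          using s by (intro divide_right_mono) auto
        with abs_ln_diff_le[OF s su sc2] show ?thesis by linarith
      qed
      have "u e - u f = (ln (softmax ?A u e) - ln (softmax ?A (\<lambda>_. c) e)) - (ln (softmax ?A u f) - ln (softmax ?A (\<lambda>_. c) f))"
        using finA ef by (simp add: ln_softmax)
      then have "\<bar>u e - u f\<bar> \<le> sqrt Q / s + sqrt Q / s"
        using bound[OF ef(1)] bound[OF ef(2)] by linarith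
      then show ?thesis by simp
    qed
    have "(u e - c)\<^sup>2 \<le> (N * (2 / s))\<^sup>2 * Q" if e: "e \<in> E" for e
    proof -
      have "\<bar>u e - (\<Sum>e\<in>E. u e) / real (card E)\<bar> \<le> N * (2 / s * sqrt Q)"
        using s Q0 by (intro abs_diff_mean_le finE e chain[rule_format] local) simp_all
      then have "\<bar>u e - c\<bar> \<le> N * (2 / s) * sqrt Q" using mean cardE by simp
      then have "\<bar>u e - c\<bar>\<^sup>2 \<le> (N * (2 / s) * sqrt Q)\<^sup>2" by (intro power_mono) auto
      then show ?thesis using Q0 by (simp only: power_mult_distrib power2_abs real_sqrt_pow2)
    qed
    then have "(\<Sum>e\<in>E. (u e - c)\<^sup>2) \<le> (\<Sum>e\<in>E. (N * (2 / s))\<^sup>2 * Q)" by (intro sum_mono)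
    then show ?thesis by (simp add: M_def)
  qed
  moreover have "M \<ge> 0" by (simp add: M_def)
  ultimately show ?thesis by (intro exI[of _ M]) auto
qed (auto intro!: exI[of _ 0])

text \<open>
  The squared distance \<open>D\<close> to the constant solution \<open>c\<close> does not increase, so \<open>u\<close> stays in a fixed ball
  around \<open>c\<close>.  There \<open>D' \<le> - \<eta> D\<close> with a fixed \<open>\<eta> > 0\<close>.
\<close>

theorem log_flow_converges:
  assumes G: "simple_graph V E" and conn: "connected_graph V E"
    and no_isolated: "\<And>x. x \<in> V \<Longrightarrow> incident E x \<noteq> {}"
    and K: "\<And>e. e \<in> E \<Longrightarrow> (\<Sum>x\<in>e. 1 / real (card (incident E x))) = K"
    and u: "log_flow E K u" and e: "e \<in> E"
  shows "((\<lambda>t. u t e) \<longlongrightarrow> (\<Sum>f\<in>E. u 0 f) / real (card E)) at_top"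
proof -
  have finE: "finite E" by (rule finite_edges[OF G])
  then have cardE: "real (card E) > 0" using e by (auto simp: card_gt_0_iff)
  define c where "c = (\<Sum>f\<in>E. u 0 f) / real (card E)"
  define D where "D t = (\<Sum>f\<in>E. (u t f - c)\<^sup>2)" for t
  define Q where "Q t = (\<Sum>x\<in>V. \<Sum>f\<in>incident E x. (softmax (incident E x) (u t) f - softmax (incident E x) (\<lambda>_. c) f)\<^sup>2)" for t
  define D' where "D' t = - 4 * (\<Sum>x\<in>V. \<Sum>f\<in>incident E x. (u t f - c) *
        (softmax (incident E x) (u t) f - softmax (incident E x) (\<lambda>_. c) f))" for t
  note const = log_flow_constant[OF G K, of c]
  have D_deriv: "(D has_real_derivative D' t) (at t within {0..})" if "0 \<le> t" for t
    using log_flow_distance_derivative[OF G u const that] unfolding D_def D'_def by simp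
  have D'_le: "D' t \<le> - 4 * Q t" for t
    unfolding D'_def Q_def by (rule log_flow_distance_dissipation[OF G])
  have term_le: "(u t f - c)\<^sup>2 \<le> D t" if "f \<in> E" for t f
    unfolding D_def using finE that by (intro member_le_sum) auto
  have D_le: "D t \<le> D 0" if "0 \<le> t" for t
    using log_flow_distance_nonincreasing[OF G u const that] unfolding D_def by simp
  have D0: "0 \<le> D 0" unfolding D_def by (intro sum_nonneg) auto
  obtain M where M: "M \<ge> 0" and gap: "\<forall>u c. (\<Sum>e\<in>E. u e) = real (card E) * c \<longrightarrow> (\<forall>e\<in>E. \<bar>u e - c\<bar> \<le> sqrt (D 0)) \<longrightarrow>
    (\<Sum>e\<in>E. (u e - c)\<^sup>2) \<le>
      M * (\<Sum>x\<in>V. \<Sum>e\<in>incident E x. (softmax (incident E x) u e - softmax (incident E x) (\<lambda>_. c) e)\<^sup>2)"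
    using distance_le_dissipation[OF G conn real_sqrt_ge_zero[OF D0]] by (elim exE conjE)
  have DQ: "D t \<le> M * Q t" if t: "0 \<le> t" for t
    unfolding D_def Q_def
  proof (rule gap[rule_format])
    show "(\<Sum>e\<in>E. u t e) = real (card E) * c"
      using log_flow_sum_conserved[OF G no_isolated K u t] cardE by (simp add: c_def)
    show "\<bar>u t e - c\<bar> \<le> sqrt (D 0)" if "e \<in> E" for e
      using order_trans[OF term_le[OF that] D_le[OF t]] by (intro real_le_rsqrt) simp
  qed
  \<comment> \<open>The summand one avoids a division by zero when \<open>M = 0\<close>.\<close>
  define \<eta> where "\<eta> = 4 / (M + 1)"
  have \<eta>: "\<eta> > 0" using M by (simp add: \<eta>_def)
  have decay: "D t * exp (\<eta> * t) \<le> D 0 * exp (\<eta> * 0)" if "0 \<le> t" for t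
  proof (rule nonincreasing_atLeast[where f = "\<lambda>t. D t * exp (\<eta> * t)"
        and f' = "\<lambda>t. D' t * exp (\<eta> * t) + (exp (\<eta> * t) * \<eta>) * D t"])
    show "((\<lambda>t. D t * exp (\<eta> * t)) has_real_derivative D' t * exp (\<eta> * t) + (exp (\<eta> * t) * \<eta>) * D t)
        (at t within {0..})" if "0 \<le> t" for t
      by (rule DERIV_mult[OF D_deriv[OF that]]) (auto intro!: derivative_eq_intros)
    show "D' t * exp (\<eta> * t) + (exp (\<eta> * t) * \<eta>) * D t \<le> 0" if "0 \<le> t" for t
    proof -
      have "0 \<le> Q t" unfolding Q_def by (intro sum_nonneg) auto
      then have "D t \<le> (M + 1) * Q t" using DQ[OF that] by (simp add: algebra_simps)
      then have "\<eta> * D t \<le> 4 * Q t" using M by (simp add: \<eta>_def field_simps)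
      then have "exp (\<eta> * t) * (D' t + \<eta> * D t) \<le> 0"
        using D'_le[of t] by (intro mult_nonneg_nonpos) auto
      then show ?thesis by (simp add: algebra_simps)
    qed
  qed (use that in auto)
  have "((\<lambda>t. (u t e - c)\<^sup>2) \<longlongrightarrow> 0) at_top"
  proof (rule tendsto_sandwich)
    show "\<forall>\<^sub>F t in at_top. 0 \<le> (u t e - c)\<^sup>2" by simp
    show "\<forall>\<^sub>F t in at_top. (u t e - c)\<^sup>2 \<le> D 0 * exp (- (\<eta> * t))"
      using eventually_ge_at_top[of 0]
    proof eventually_elim
      case (elim t)
      have "D t \<le> D 0 * exp (- (\<eta> * t))" using decay[OF elim] by (simp add: exp_minus field_simps)
      then show ?case using term_le[OF e, of t] by linarith
    qed
    have "filterlim (\<lambda>t. \<eta> * t) at_top at_top"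
      using \<eta> by (intro filterlim_tendsto_pos_mult_at_top[OF tendsto_const] filterlim_ident)
    then have "((\<lambda>t. exp (- (\<eta> * t))) \<longlongrightarrow> 0) at_top"
      by (intro filterlim_compose[OF exp_at_bot]) (simp add: filterlim_uminus_at_bot)
    then show "((\<lambda>t. D 0 * exp (- (\<eta> * t))) \<longlongrightarrow> 0) at_top" by (rule tendsto_mult_right_zero)
  qed simp
  then have "((\<lambda>t. u t e - c) \<longlongrightarrow> 0) at_top"
    using tendsto_real_sqrt tendsto_rabs_zero_cancel by fastforce
  then show ?thesis unfolding c_def[symmetric] by (rule LIM_zero_cancel)
qed

section \<open>Cone coordinates on the disc\<close>

text \<open>
  Sides \<open>i\<close> and \<open>j\<close> of a \<open>k\<close>-gon, each parametrised by the unit interval, have the points with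
  parameters \<open>a\<close> and \<open>b\<close> in common: the end of each side is the start of the next.
\<close>

definition glued_params :: "nat \<Rightarrow> nat \<Rightarrow> real \<Rightarrow> nat \<Rightarrow> real \<Rightarrow> bool" where
  "glued_params k i a j b \<longleftrightarrow> (i = j \<and> a = b) \<or> (a = 1 \<and> b = 0 \<and> j = Suc i mod k)
     \<or> (a = 0 \<and> b = 1 \<and> i = Suc j mod k)"

lemma cis_eq_iff_int: "cis x = cis y \<longleftrightarrow> (\<exists>n::int. x = y + 2 * pi * n)"
  using sin_cos_eq_iff[of x y] by (auto simp: complex_eq_iff)

lemma cis_Suc_mod:
  assumes "j < k" shows "cis (2 * pi * real (Suc j mod k) / real k) = cis (2 * pi * (real j + 1) / real k)"
proof (cases "Suc j = k")
  case True
  then have "2 * pi * (real j + 1) / real k = 2 * pi" using assms by (auto simp: field_simps)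
  then show ?thesis using True by (simp only:) simp
next
  case False
  then show ?thesis using assms by (simp add: add.commute)
qed

lemma cis_sector_eq_iff:
  assumes ij: "i < k" "j < k" and ab: "a \<in> {0..1}" "b \<in> {0..1}"
  shows "cis (2 * pi * (real i + a) / real k) = cis (2 * pi * (real j + b) / real k)
    \<longleftrightarrow> glued_params k i a j b"
proof
  assume "cis (2 * pi * (real i + a) / real k) = cis (2 * pi * (real j + b) / real k)"
  then obtain n :: int where "2 * pi * (real i + a) / real k = 2 * pi * (real j + b) / real k + 2 * pi * n"
    by (auto simp: cis_eq_iff_int)
  then have "2 * pi * (real i + a) = 2 * pi * (real j + b + real k * n)"
    using ij by (simp add: field_simps)
  then have eq: "real i + a = real j + b + real k * n"
    using mult_left_cancel[of "2 * pi"] by simp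
  have lt: "real i + 1 \<le> real k" "real j + 1 \<le> real k" using ij by auto
  have ab': "0 \<le> a" "a \<le> 1" "0 \<le> b" "b \<le> 1" using ab by auto
  have "real k * n \<le> real k * 1" "real k * (-1) \<le> real k * n" using eq lt ab' by linarith+
  then have "real_of_int n \<le> 1" "-1 \<le> real_of_int n"
    using mult_left_le_imp_le[of "real k"] ij by (metis gr_implies_not0 of_nat_0_less_iff not_gr_zero)+
  then consider "n = 0" | "n = 1" | "n = -1" by linarith
  then show "glued_params k i a j b"
  proof cases
    case 1
    then have eq: "real i + a = real j + b" using eq by simp
    consider "i = j" | "i < j" | "j < i" by linarith
    then show ?thesis
    proof cases
      case 2
      then have "real i + 1 \<le> real j" by linarith
      then have "a = 1" "b = 0" "real j = real i + 1" using eq ab by auto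
      then show ?thesis using ij by (auto simp: glued_params_def)
    next
      case 3
      then have "real j + 1 \<le> real i" by linarith
      then have "a = 0" "b = 1" "real i = real j + 1" using eq ab by auto
      then show ?thesis using ij by (auto simp: glued_params_def)
    qed (use eq in \<open>auto simp: glued_params_def\<close>)
  next
    case 2
    then have "a = 1" "b = 0" "j = 0" "real i + 1 = real k" using eq ab lt by auto
    then have "Suc i = k" by linarith
    then show ?thesis using \<open>a = 1\<close> \<open>b = 0\<close> \<open>j = 0\<close> by (auto simp: glued_params_def)
  next
    case 3
    then have "b = 1" "a = 0" "i = 0" "real j + 1 = real k" using eq ab lt by auto
    then have "Suc j = k" by linarith
    then show ?thesis using \<open>b = 1\<close> \<open>a = 0\<close> \<open>i = 0\<close> by (auto simp: glued_params_def)
  qed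
next
  show "glued_params k i a j b \<Longrightarrow> cis (2 * pi * (real i + a) / real k) = cis (2 * pi * (real j + b) / real k)"
    using cis_Suc_mod[of i k] cis_Suc_mod[of j k] ij by (auto simp: glued_params_def)
qed

definition side_repar :: "(real \<Rightarrow> real) \<Rightarrow> bool" where
  "side_repar \<tau> \<longleftrightarrow> continuous_on {0..1} \<tau> \<and> bij_betw \<tau> {0..1} {0..1} \<and> \<tau> 0 = 0 \<and> \<tau> 1 = 1"

text \<open>
  Reparametrising every side separately does not affect the gluing.  This is why the disc and the
  polygon will have the same cone coordinates.
\<close>

lemma glued_params_repar:
  assumes \<tau>: "side_repar (\<tau> i)" "side_repar (\<tau> j)" and ab: "a \<in> {0..1}" "b \<in> {0..1}"
  shows "glued_params k i (\<tau> i a) j (\<tau> j b) \<longleftrightarrow> glued_params k i a j b"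
proof -
  have inj: "\<tau> i x = \<tau> i y \<longleftrightarrow> x = y" "\<tau> j x = \<tau> j y \<longleftrightarrow> x = y" if "x \<in> {0..1}" "y \<in> {0..1}" for x y
    using \<tau> that unfolding side_repar_def bij_betw_def by (meson inj_on_eq_iff)+
  have ends: "\<tau> i 0 = 0" "\<tau> i 1 = 1" "\<tau> j 0 = 0" "\<tau> j 1 = 1" using \<tau> by (auto simp: side_repar_def)
  show ?thesis
    using inj(1)[OF ab(1), of 0] inj(1)[OF ab(1), of 1] inj(2)[OF ab(2), of 0] inj(2)[OF ab(2), of 1] inj(1)[OF ab] ends
    unfolding glued_params_def by auto
qed

lemma polar_eq_iff:
  assumes "0 \<le> m" "0 \<le> n"
  shows "of_real m * cis x = of_real n * cis y \<longleftrightarrow> (m = 0 \<and> n = 0) \<or> (m = n \<and> cis x = cis y)"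
proof
  assume eq: "of_real m * cis x = of_real n * cis y"
  then have "norm (of_real m * cis x) = norm (of_real n * cis y)" by simp
  then have "m = n" using assms by (simp add: norm_mult)
  then show "(m = 0 \<and> n = 0) \<or> (m = n \<and> cis x = cis y)" using eq by auto
qed auto

lemma sector_coordinates:
  assumes "0 < k"
  obtains j a where "j < k" "a \<in> {0..1}" "z = of_real (norm z) * cis (2 * pi * (real j + a) / real k)"
proof -
  \<comment> \<open>The argument in units in which each of the \<open>k\<close> sectors has length one.\<close>
  define x where "x = Arg2pi z * real k / (2 * pi)"
  have "0 \<le> Arg2pi z" "Arg2pi z < 2 * pi" using Arg2pi by auto
  then have "0 \<le> x" and xk: "x < real k" using assms unfolding x_def by (auto simp: field_simps)
  define j where "j = nat \<lfloor>x\<rfloor>"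
  have "real j \<le> x" "x - real j \<le> 1" using \<open>0 \<le> x\<close> unfolding j_def by linarith+
  moreover have "j < k" using xk \<open>real j \<le> x\<close> by linarith
  moreover have "z = of_real (norm z) * cis (2 * pi * (real j + (x - real j)) / real k)"
    using Arg2pi_eq[of z] assms unfolding x_def by (simp add: cis_conv_exp mult.commute)
  ultimately show ?thesis by (intro that[of j "x - real j"]) auto
qed

section \<open>Cone coordinates on the regular polygon\<close>

definition corner :: "real \<Rightarrow> nat \<Rightarrow> nat \<Rightarrow> complex" where
  "corner R k j = of_real R * cis (2 * pi * real j / real k)"

text \<open>
  A point of a side of the regular \<open>k\<close>-gon in polar coordinates.  The angle is measured from the
  midpoint of the side; \<open>side_frac\<close> rescales it so that each side contributes one unit and a whole
  turn has length \<open>k\<close>; the radius is relative to the circumradius.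
\<close>

definition side_angle :: "nat \<Rightarrow> real \<Rightarrow> real" where
  "side_angle k s = arctan ((2 * s - 1) * tan (pi / real k))"

definition side_frac :: "nat \<Rightarrow> real \<Rightarrow> real" where
  "side_frac k s = (1 + side_angle k s * real k / pi) / 2"

definition side_radius :: "nat \<Rightarrow> real \<Rightarrow> real" where
  "side_radius k s = cos (pi / real k) / cos (side_angle k s)"

definition side_point :: "real \<Rightarrow> nat \<Rightarrow> nat \<Rightarrow> real \<Rightarrow> complex" where
  "side_point R k j s = corner R k j + of_real s * (corner R k (Suc j mod k) - corner R k j)"

lemma pi_div_k:
  assumes "3 \<le> k" shows "0 < pi / real k" "pi / real k < pi / 2"
    "0 < sin (pi / real k)" "0 < cos (pi / real k)" "0 < tan (pi / real k)"
proof -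
  show *: "0 < pi / real k" "pi / real k < pi / 2" using assms by (auto simp: field_simps)
  show "0 < sin (pi / real k)" using * pi_gt_zero by (intro sin_gt_zero) linarith+
  show "0 < cos (pi / real k)" using * by (intro cos_gt_zero)
  show "0 < tan (pi / real k)" using * by (intro tan_gt_zero)
qed

text \<open>
  In the frame of the midpoint direction, with \<open>a = \<pi> / k\<close>, the point with parameter \<open>s\<close> on a side is
  \<open>cos a + \<i> (2 s - 1) sin a\<close>, of argument \<open>side_angle k s\<close>.
\<close>

lemma side_point_polar:
  assumes k: "3 \<le> k" and j: "j < k"
  shows "side_point R k j s = of_real (R * side_radius k s) * cis (2 * pi * (real j + side_frac k s) / real k)"
proof -
  let ?a = "pi / real k" and ?\<psi> = "side_angle k s"
  note pk = pi_div_k[OF k]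
  have cos\<psi>: "0 < cos ?\<psi>" unfolding side_angle_def by (intro cos_gt_zero_pi arctan_lbound arctan_ubound) 
  have c: "cos ?a = side_radius k s * cos ?\<psi>" using cos\<psi> by (simp add: side_radius_def)
  have "tan ?\<psi> = (2 * s - 1) * tan ?a" by (simp add: side_angle_def tan_arctan)
  then have "sin ?\<psi> = (2 * s - 1) * (sin ?a / cos ?a) * cos ?\<psi>"
    using cos\<psi> by (simp add: tan_def field_simps)
  then have sn: "(2 * s - 1) * sin ?a = side_radius k s * sin ?\<psi>"
    using pk cos\<psi> by (simp add: side_radius_def field_simps)
  have "(1 - of_real s) * cis (- ?a) + of_real s * cis ?a = of_real (side_radius k s) * cis ?\<psi>"
    using c sn by (simp add: complex_eq_iff algebra_simps)
  then have "cis (2 * pi * real j / real k + ?a) * ((1 - of_real s) * cis (- ?a) + of_real s * cis ?a)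
      = cis (2 * pi * real j / real k + ?a) * (of_real (side_radius k s) * cis ?\<psi>)" by simp
  moreover have "cis (2 * pi * real j / real k + ?a) * cis (- ?a) = cis (2 * pi * real j / real k)"
    by (simp add: cis_mult)
  moreover have "cis (2 * pi * real j / real k + ?a) * cis ?a = cis (2 * pi * (real j + 1) / real k)"
    by (simp add: cis_mult) (simp add: add_divide_distrib algebra_simps)
  moreover have "2 * pi * real j / real k + ?a + ?\<psi> = 2 * pi * (real j + side_frac k s) / real k"
    using k by (simp add: side_frac_def field_simps)
  then have "cis (2 * pi * real j / real k + ?a) * cis ?\<psi> = cis (2 * pi * (real j + side_frac k s) / real k)"
    by (simp only: cis_mult)
  ultimately have "(1 - of_real s) * cis (2 * pi * real j / real k) + of_real s * cis (2 * pi * (real j + 1) / real k)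
     = of_real (side_radius k s) * cis (2 * pi * (real j + side_frac k s) / real k)"
    by (simp add: distrib_left mult.left_commute[of "cis _" "1 - of_real s"] mult.left_commute[of "cis _" "of_real _"])
  then have "of_real R * ((1 - of_real s) * cis (2 * pi * real j / real k) + of_real s * cis (2 * pi * (real j + 1) / real k))
     = of_real R * (of_real (side_radius k s) * cis (2 * pi * (real j + side_frac k s) / real k))" by simp
  moreover have "side_point R k j s = of_real R * ((1 - of_real s) * cis (2 * pi * real j / real k) + of_real s * cis (2 * pi * (real j + 1) / real k))"
    unfolding side_point_def corner_def cis_Suc_mod[OF j] by (simp add: algebra_simps)
  ultimately show ?thesis by (simp add: mult.assoc)
qed

lemma side_angle_ends:
  assumes "3 \<le> k" shows "side_angle k 0 = - (pi / real k)" "side_angle k 1 = pi / real k"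
proof -
  have "- (pi / 2) < pi / real k" using pi_div_k(1)[OF assms] pi_gt_zero by linarith
  then have "arctan (tan (pi / real k)) = pi / real k" using pi_div_k(2)[OF assms] by (rule arctan_tan)
  then show "side_angle k 0 = - (pi / real k)" "side_angle k 1 = pi / real k"
    by (simp_all add: side_angle_def arctan_minus)
qed

text \<open>
  Moving along a side at constant speed turns the direction seen from the centre monotonically, so
  the radial projection of a side to its sector of the circle is an admissible reparametrisation.
\<close>

lemma side_frac_repar:
  assumes k: "3 \<le> k" shows "side_repar (side_frac k)"
proof -
  note pk = pi_div_k[OF k]
  have cont: "continuous_on {0..1} (side_frac k)"
    unfolding side_frac_def side_angle_def by (intro continuous_intros) auto
  have ends: "side_frac k 0 = 0" "side_frac k 1 = 1"
    using k by (auto simp: side_frac_def side_angle_ends)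
  have mono: "side_frac k s < side_frac k t" if "s < t" for s t
  proof -
    have "side_angle k s < side_angle k t"
      unfolding side_angle_def using that pk by (intro arctan_monotone) simp
    then show ?thesis using k by (simp add: side_frac_def divide_strict_right_mono)
  qed
  have inj: "inj_on (side_frac k) {0..1}"
    by (rule linorder_inj_onI') (use mono in force)
  have "side_frac k ` {0..1} = {0..1}"
  proof
    have "mono (side_frac k)" using mono by (auto intro!: monoI simp: le_less)
    then show "side_frac k ` {0..1} \<subseteq> {0..1}"
      using monoD[of "side_frac k" 0] monoD[of "side_frac k" _ 1] ends by fastforce
    show "{0..1} \<subseteq> side_frac k ` {0..1}"
    proof
      fix y :: real assume "y \<in> {0..1}"
      then show "y \<in> side_frac k ` {0..1}"
        using IVT'[of "side_frac k" 0 y 1] ends cont by force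
    qed
  qed
  then show ?thesis using cont inj ends by (simp add: side_repar_def bij_betw_def)
qed

lemma side_radius_pos:
  assumes "3 \<le> k" shows "0 < side_radius k s"
proof -
  have "0 < cos (side_angle k s)"
    unfolding side_angle_def by (intro cos_gt_zero_pi arctan_lbound arctan_ubound)
  then show ?thesis using pi_div_k(4)[OF assms] by (simp add: side_radius_def)
qed

lemma side_radius_ends: assumes "3 \<le> k" shows "side_radius k 0 = 1" "side_radius k 1 = 1"
  using pi_div_k[OF assms] side_angle_ends[OF assms] by (simp_all add: side_radius_def)

text \<open>
  Cone coordinates \<open>(j, s, r)\<close>: side, position on the side, and distance from the centre relative to that
  of the boundary in the same direction.  Using the discrete coordinate \<open>j\<close> instead of one angle avoids
  piecewise definitions of maps on the boundary.
\<close>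

definition disc_point :: "nat \<Rightarrow> (nat \<Rightarrow> real \<Rightarrow> real) \<Rightarrow> nat \<times> real \<times> real \<Rightarrow> complex" where
  "disc_point k \<tau> = (\<lambda>(j, s, r). of_real r * cis (2 * pi * (real j + \<tau> j s) / real k))"

definition polygon_point :: "real \<Rightarrow> nat \<Rightarrow> nat \<times> real \<times> real \<Rightarrow> complex" where
  "polygon_point R k = (\<lambda>(j, s, r). of_real r * side_point R k j s)"

abbreviation "cone_params k \<equiv> {..<k} \<times> {0..1::real} \<times> {0..1::real}"

text \<open>
  The right-hand side does not depend on \<open>\<tau>\<close> and agrees with that of \<open>polygon_point_eq_iff\<close>.
\<close>

lemma disc_point_eq_iff:
  assumes \<tau>: "\<And>j. j < k \<Longrightarrow> side_repar (\<tau> j)"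
    and p: "(i, s, r) \<in> cone_params k" "(j, s', r') \<in> cone_params k"
  shows "disc_point k \<tau> (i, s, r) = disc_point k \<tau> (j, s', r')
    \<longleftrightarrow> (r = 0 \<and> r' = 0) \<or> (r = r' \<and> glued_params k i s j s')"
proof -
  have "\<tau> i s \<in> {0..1}" "\<tau> j s' \<in> {0..1}"
    using \<tau>[of i] \<tau>[of j] p by (auto simp: side_repar_def bij_betw_def)
  then show ?thesis
    using p \<tau> unfolding disc_point_def by (simp add: polar_eq_iff cis_sector_eq_iff glued_params_repar del: of_real_mult)
qed

lemma polygon_point_eq_iff:
  assumes k: "3 \<le> k" and R: "0 < R"
    and p: "(i, s, r) \<in> cone_params k" "(j, s', r') \<in> cone_params k"
  shows "polygon_point R k (i, s, r) = polygon_point R k (j, s', r')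
    \<longleftrightarrow> (r = 0 \<and> r' = 0) \<or> (r = r' \<and> glued_params k i s j s')"
proof -
  note sf = side_frac_repar[OF k]
  have sf01: "side_frac k s \<in> {0..1}" "side_frac k s' \<in> {0..1}"
    using sf p by (auto simp: side_repar_def bij_betw_def)
  let ?m = "r * (R * side_radius k s)" and ?n = "r' * (R * side_radius k s')"
  have pos: "0 < R * side_radius k s" "0 < R * side_radius k s'" using R side_radius_pos[OF k] by auto
  have same: "glued_params k i s j s' \<Longrightarrow> side_radius k s = side_radius k s'"
    by (auto simp: glued_params_def side_radius_ends[OF k])
  have "polygon_point R k (i, s, r) = polygon_point R k (j, s', r') \<longleftrightarrow>
      of_real ?m * cis (2 * pi * (real i + side_frac k s) / real k) = of_real ?n * cis (2 * pi * (real j + side_frac k s') / real k)"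
    using p by (simp add: polygon_point_def side_point_polar[OF k] mult.assoc)
  also have "\<dots> \<longleftrightarrow> (?m = 0 \<and> ?n = 0) \<or> (?m = ?n \<and> glued_params k i s j s')"
    using p pos sf01 glued_params_repar[of "\<lambda>_. side_frac k" i j s s' k, OF sf sf]
    by (subst polar_eq_iff) (simp_all add: cis_sector_eq_iff)
  also have "\<dots> \<longleftrightarrow> (r = 0 \<and> r' = 0) \<or> (r = r' \<and> glued_params k i s j s')"
    using pos same by auto
  finally show ?thesis .
qed

lemma continuous_on_cone_params:
  fixes h :: "nat \<times> real \<times> real \<Rightarrow> 'b::topological_space"
  assumes "\<And>j. j < k \<Longrightarrow> continuous_on ({0..1} \<times> {0..1}) (\<lambda>p. h (j, p))"
  shows "continuous_on (cone_params k) h"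
proof -
  have "continuous_on (\<Union>j\<in>{..<k}. {j} \<times> ({0..1::real} \<times> {0..1::real})) h"
  proof (rule continuous_on_closed_Union)
    fix j assume "j \<in> {..<k}"
    then have "continuous_on ({j} \<times> ({0..1} \<times> {0..1})) (\<lambda>p. h (j, snd p))"
      by (intro continuous_on_compose2[OF assms[of j]] continuous_intros) auto
    then show "continuous_on ({j} \<times> ({0..1} \<times> {0..1})) h"
      by (rule continuous_on_eq) auto
  qed (auto intro!: closed_Times)
  also have "(\<Union>j\<in>{..<k}. {j} \<times> ({0..1::real} \<times> {0..1::real})) = cone_params k" by auto
  finally show ?thesis .
qed

lemma disc_point_image:
  assumes k: "0 < k" and \<tau>: "\<And>j. j < k \<Longrightarrow> side_repar (\<tau> j)"
  shows "disc_point k \<tau> ` cone_params k = cball 0 1"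
proof
  show "disc_point k \<tau> ` cone_params k \<subseteq> cball 0 1"
    by (auto simp: disc_point_def norm_mult)
  show "cball 0 1 \<subseteq> disc_point k \<tau> ` cone_params k"
  proof
    fix z :: complex assume z: "z \<in> cball 0 1"
    obtain j a where ja: "j < k" "a \<in> {0..1}" "z = of_real (norm z) * cis (2 * pi * (real j + a) / real k)"
      using sector_coordinates[OF k] by blast
    have "a \<in> \<tau> j ` {0..1}" using \<tau>[OF ja(1)] ja(2) by (simp add: side_repar_def bij_betw_def)
    then obtain s where "s \<in> {0..1}" "a = \<tau> j s" by blast
    then show "z \<in> disc_point k \<tau> ` cone_params k"
      using z ja by (intro image_eqI[of _ _ "(j, s, norm z)"]) (auto simp: disc_point_def)
  qed
qed

lemma inner_polar_cis: "cis b \<bullet> (of_real m * cis x) = m * cos (x - b)"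
  by (simp add: inner_complex_def cos_diff algebra_simps)

text \<open>
  The outer unit normal of side \<open>j\<close>, which points to its midpoint.
\<close>

definition side_normal :: "nat \<Rightarrow> nat \<Rightarrow> complex" where
  "side_normal k j = cis (2 * pi * (real j + 1 / 2) / real k)"

lemma cos_less_cos_outside:
  assumes "0 \<le> a" "a < x" "x < 2 * pi - a" shows "cos x < cos a"
proof (cases "x \<le> pi")
  case True then show ?thesis using assms by (intro cos_monotone_0_pi) auto
next
  case False
  then have "cos (2 * pi - x) < cos a" using assms by (intro cos_monotone_0_pi) auto
  then show ?thesis by (simp add: cos_diff)
qed

text \<open>
  The angle between the normal of side \<open>j\<close> and corner \<open>i\<close> is an odd multiple of \<open>\<pi> / k\<close>, and among these
  the cosine is largest exactly at the two ends of the side.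
\<close>

lemma side_normal_corner:
  assumes k: "3 \<le> k" and R: "0 < R" and ij: "i < k" "j < k"
  shows "i = j \<or> i = Suc j mod k \<Longrightarrow> side_normal k j \<bullet> corner R k i = R * cos (pi / real k)"
    and "\<not> (i = j \<or> i = Suc j mod k) \<Longrightarrow> side_normal k j \<bullet> corner R k i < R * cos (pi / real k)"
proof -
  let ?a = "pi / real k"
  have a: "0 < ?a" "?a * (2 * real k - 1) = 2 * pi - ?a" using k by (auto simp: field_simps)
  have inner: "side_normal k j \<bullet> corner R k i = R * cos (?a * (2 * real i - 2 * real j - 1))"
  proof -
    have "2 * pi * real i / real k - 2 * pi * (real j + 1 / 2) / real k = ?a * (2 * real i - 2 * real j - 1)"
      using k by (simp add: field_simps)
    then show ?thesis unfolding side_normal_def corner_def inner_polar_cis by simp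
  qed
  show "side_normal k j \<bullet> corner R k i = R * cos ?a" if "i = j \<or> i = Suc j mod k"
    using that
  proof
    assume "i = j"
    then show ?thesis unfolding inner by simp
  next
    assume i: "i = Suc j mod k"
    show ?thesis
      unfolding side_normal_def corner_def i cis_Suc_mod[OF ij(2)] inner_polar_cis 
      using k by (simp add: diff_divide_distrib[symmetric] algebra_simps)
  qed
  show "side_normal k j \<bullet> corner R k i < R * cos ?a" if ne: "\<not> (i = j \<or> i = Suc j mod k)"
  proof -
    have "cos (?a * (2 * real i - 2 * real j - 1)) < cos ?a"
    proof (cases "j < i")
      case True
      then have "i \<noteq> Suc j" using ne ij by auto
      then have "real i \<ge> real j + 2" "real i + 1 \<le> real k" using True ij by linarith+
      then have "1 < 2 * real i - 2 * real j - 1" "2 * real i - 2 * real j - 1 < 2 * real k - 1" by linarith+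
      then have "?a * 1 < ?a * (2 * real i - 2 * real j - 1)" "?a * (2 * real i - 2 * real j - 1) < ?a * (2 * real k - 1)"
        using a(1) by (intro mult_strict_left_mono; simp)+
      then show ?thesis using a by (intro cos_less_cos_outside) linarith+
    next
      case False
      then have "i < j" using ne by auto
      then have "real i + 1 \<le> real j" "real j + 1 \<le> real k" using ij by linarith+
      have "real j - real i + 2 \<le> real k"
      proof (rule ccontr)
        assume "\<not> ?thesis"
        then have "i = 0" "Suc j = k" using \<open>real j + 1 \<le> real k\<close> \<open>i < j\<close> ij by linarith+
        then show False using ne by simp
      qed
      then have "1 < 2 * real j - 2 * real i + 1" "2 * real j - 2 * real i + 1 < 2 * real k - 1"
        using \<open>real i + 1 \<le> real j\<close> by linarith+
      then have "?a * 1 < ?a * (2 * real j - 2 * real i + 1)" "?a * (2 * real j - 2 * real i + 1) < ?a * (2 * real k - 1)"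
        using a(1) by (intro mult_strict_left_mono; simp)+
      then have "cos (?a * (2 * real j - 2 * real i + 1)) < cos ?a"
        using a by (intro cos_less_cos_outside) linarith+
      moreover have "cos (?a * (2 * real i - 2 * real j - 1)) = cos (?a * (2 * real j - 2 * real i + 1))"
        by (subst cos_minus[symmetric]) (simp add: algebra_simps del: cos_minus)
      ultimately show ?thesis by simp
    qed
    then show ?thesis unfolding inner using R by simp
  qed
qed

abbreviation regular_polygon :: "real \<Rightarrow> nat \<Rightarrow> complex set" where
  "regular_polygon R k \<equiv> convex hull (corner R k ` {..<k})"

lemma side_normal_polygon_le:
  assumes k: "3 \<le> k" and R: "0 < R" and j: "j < k" and z: "z \<in> regular_polygon R k"
  shows "side_normal k j \<bullet> z \<le> R * cos (pi / real k)"
proof -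
  have "corner R k ` {..<k} \<subseteq> {z. side_normal k j \<bullet> z \<le> R * cos (pi / real k)}"
    using side_normal_corner[OF k R _ j] by (auto intro: less_imp_le eq_refl)
  then have "regular_polygon R k \<subseteq> {z. side_normal k j \<bullet> z \<le> R * cos (pi / real k)}"
    by (rule hull_minimal) (rule convex_halfspace_le)
  then show ?thesis using z by blast
qed

lemma side_normal_side_point:
  assumes k: "3 \<le> k" and R: "0 < R" and j: "j < k"
  shows "side_normal k j \<bullet> side_point R k j s = R * cos (pi / real k)"
proof -
  have "Suc j mod k < k" using k by simp
  then show ?thesis
    using side_normal_corner(1)[OF k R j j] side_normal_corner(1)[OF k R _ j, of "Suc j mod k"]
    by (simp add: side_point_def inner_add_right inner_diff_right flip: scaleR_conv_of_real)
qed

text \<open>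
  Points with \<open>r = 1\<close> maximise the linear functional of their side, which an interior point cannot do.
\<close>

lemma polygon_point_interior:
  assumes k: "3 \<le> k" and R: "0 < R" and p: "(j, s, r) \<in> cone_params k"
    and int: "polygon_point R k (j, s, r) \<in> interior (regular_polygon R k)"
  shows "r < 1"
proof -
  have j: "j < k" using p by simp
  have "regular_polygon R k \<subseteq> {z. side_normal k j \<bullet> z \<le> R * cos (pi / real k)}"
    using side_normal_polygon_le[OF k R j] by blast
  then have "interior (regular_polygon R k) \<subseteq> interior {z. side_normal k j \<bullet> z \<le> R * cos (pi / real k)}"
    by (rule interior_mono)
  also have "\<dots> = {z. side_normal k j \<bullet> z < R * cos (pi / real k)}"
    by (rule interior_halfspace_le) (simp add: side_normal_def)
  finally have "side_normal k j \<bullet> polygon_point R k (j, s, r) < R * cos (pi / real k)"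
    using int by blast
  then have "r * (R * cos (pi / real k)) < 1 * (R * cos (pi / real k))"
    using side_normal_side_point[OF k R j, of s]
    by (simp add: polygon_point_def flip: scaleR_conv_of_real)
  then show ?thesis using R pi_div_k(4)[OF k] by (simp add: mult_less_cancel_right)
qed

lemma zero_in_regular_polygon:
  assumes k: "3 \<le> k" shows "0 \<in> regular_polygon R k"
proof -
  have "corner R k i = of_real R * cis (2 * pi / real k) ^ i" for i
  proof -
    have "2 * pi * real i / real k = real i * (2 * pi / real k)" by simp
    then show ?thesis unfolding corner_def by (simp only: Complex.DeMoivre)
  qed
  then have "(\<Sum>i<k. corner R k i) = of_real R * (\<Sum>i<k. cis (2 * pi / real k) ^ i)"
    by (simp add: sum_distrib_left)
  also have "\<dots> = 0"
  proof -
    have "cis (2 * pi / real k) \<noteq> 1"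
      using cis_sector_eq_iff[of 1 k 0 0 0] k by (simp add: glued_params_def)
    moreover have "cis (2 * pi / real k) ^ k = 1"
      unfolding Complex.DeMoivre using k by simp
    ultimately show ?thesis by (simp add: sum_gp_strict)
  qed
  finally have sum0: "(\<Sum>i<k. corner R k i) = 0" .
  have "(\<Sum>i<k. (1 / real k) *\<^sub>R corner R k i) \<in> regular_polygon R k"
    using k by (intro convex_sum) (auto intro: hull_inc)
  then show ?thesis by (simp add: sum0 flip: scaleR_sum_right)
qed

text \<open>
  A point of the polygon in direction \<open>2 \<pi> (j + a) / k\<close> satisfies the half-plane inequality of side \<open>j\<close>,
  and in polar form this says that it is no further out than the point of the side in this
  direction.
\<close>

lemma polygon_point_image:
  assumes k: "3 \<le> k" and R: "0 < R"
  shows "polygon_point R k ` cone_params k = regular_polygon R k"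
proof
  show "polygon_point R k ` cone_params k \<subseteq> regular_polygon R k"
  proof clarify
    fix j s r assume p: "j < k" "s \<in> {0..1::real}" "r \<in> {0..1::real}"
    let ?H = "regular_polygon R k"
    have "Suc j mod k < k" using k by simp
    then have "corner R k j \<in> ?H" "corner R k (Suc j mod k) \<in> ?H" using p by (auto intro: hull_inc)
    then have "(1 - s) *\<^sub>R corner R k j + s *\<^sub>R corner R k (Suc j mod k) \<in> ?H"
      using p by (intro convexD[OF convex_convex_hull]) auto
    then have "(1 - r) *\<^sub>R 0 + r *\<^sub>R ((1 - s) *\<^sub>R corner R k j + s *\<^sub>R corner R k (Suc j mod k)) \<in> ?H"
      using p by (intro convexD[OF convex_convex_hull zero_in_regular_polygon[OF k]]) auto
    then show "polygon_point R k (j, s, r) \<in> ?H"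
      by (simp add: polygon_point_def side_point_def scaleR_conv_of_real algebra_simps)
  qed
  show "regular_polygon R k \<subseteq> polygon_point R k ` cone_params k"
  proof
    fix z assume z: "z \<in> regular_polygon R k"
    have "0 < k" using k by simp
    then obtain j a where ja: "j < k" "a \<in> {0..1}" and zeq: "z = of_real (norm z) * cis (2 * pi * (real j + a) / real k)"
      using sector_coordinates by blast
    have "a \<in> side_frac k ` {0..1}" using side_frac_repar[OF k] ja(2) by (simp add: side_repar_def bij_betw_def)
    then obtain s where s: "s \<in> {0..1}" "a = side_frac k s" by blast
    have cos_pos: "0 < cos (side_angle k s)"
      unfolding side_angle_def by (intro cos_gt_zero_pi arctan_lbound arctan_ubound)
    have "side_normal k j \<bullet> z = norm z * cos (2 * pi * (real j + a) / real k - 2 * pi * (real j + 1 / 2) / real k)"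
      unfolding side_normal_def by (subst zeq) (rule inner_polar_cis)
    also have "2 * pi * (real j + a) / real k - 2 * pi * (real j + 1 / 2) / real k = side_angle k s"
      using k by (simp add: s side_frac_def field_simps)
    finally have "norm z * cos (side_angle k s) \<le> R * cos (pi / real k)"
      using side_normal_polygon_le[OF k R ja(1) z] by simp
    then have le: "norm z \<le> R * side_radius k s" using cos_pos by (simp add: side_radius_def field_simps)
    have pos: "0 < R * side_radius k s" using R side_radius_pos[OF k] by simp
    define r where "r = norm z / (R * side_radius k s)"
    have r: "r \<in> {0..1}" using le pos by (simp add: r_def)
    have "polygon_point R k (j, s, r) = of_real (r * (R * side_radius k s)) * cis (2 * pi * (real j + a) / real k)"
      using side_point_polar[OF k ja(1), of R s] s by (simp add: polygon_point_def mult.assoc)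
    also have "r * (R * side_radius k s) = norm z" using R side_radius_pos[OF k, of s] by (simp add: r_def)
    also note zeq[symmetric]
    finally show "z \<in> polygon_point R k ` cone_params k"
      using ja s r by (intro image_eqI[of _ _ "(j, s, r)"]) auto
  qed
qed

lemma inj_on_corner:
  assumes "3 \<le> k" "0 < R" shows "inj_on (corner R k) {..<k}"
proof
  fix i j assume "i \<in> {..<k}" "j \<in> {..<k}" "corner R k i = corner R k j"
  then show "i = j"
    using cis_sector_eq_iff[of i k j 0 0] assms by (auto simp: corner_def glued_params_def)
qed

lemma convex_polygon_corner:
  assumes k: "3 \<le> k" and R: "0 < R" shows "convex_polygon k (corner R k)"
  unfolding convex_polygon_def
proof (intro conjI allI impI)
  show "inj_on (corner R k) {..<k}" by (rule inj_on_corner[OF k R])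
  fix j assume j: "j < k"
  let ?q = "corner R k (Suc j mod k)" and ?S = "corner R k ` {..<k}"
  let ?T = "{corner R k j, ?q}"
  have sj: "Suc j mod k < k" "Suc j mod k \<noteq> j" using k j by (auto simp: mod_Suc)
  have "?T \<subseteq> {z. side_normal k j \<bullet> z = R * cos (pi / real k)}"
    using side_normal_corner(1)[OF k R _ j] j sj by auto
  then have aff: "affine hull ?T \<subseteq> {z. side_normal k j \<bullet> z = R * cos (pi / real k)}"
    by (rule hull_minimal) (rule affine_hyperplane)
  have "?S - ?T \<subseteq> {z. side_normal k j \<bullet> z < R * cos (pi / real k)}"
    using side_normal_corner(2)[OF k R _ j] by auto
  then have "convex hull (?S - ?T) \<subseteq> {z. side_normal k j \<bullet> z < R * cos (pi / real k)}"
    by (rule hull_minimal) (rule convex_halfspace_lt)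
  with aff have "affine hull ?T \<inter> convex hull (?S - ?T) = {}" by force
  then have "convex hull ?T face_of convex hull ?S"
    using j sj by (intro face_of_convex_hulls) auto
  moreover have "aff_dim (convex hull ?T) = 1"
    using inj_on_corner[OF k R] j sj by (auto simp: aff_dim_convex_hull inj_on_def)
  ultimately show "closed_segment (corner R k j) ?q edge_of convex hull ?S"
    by (simp add: edge_of_def segment_convex_hull)
qed (rule k)

lemma dist_corner:
  assumes k: "3 \<le> k" and c: "0 < c" and j: "j < k" and R: "R = c / (2 * sin (pi / real k))"
  shows "dist (corner R k j) (corner R k (Suc j mod k)) = c"
proof -
  let ?a = "pi / real k"
  note pk = pi_div_k[OF k]
  have "corner R k (Suc j mod k) - corner R k j = of_real R * (cis (2 * pi * real j / real k + ?a) * (cis ?a - cis (- ?a)))"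
    unfolding corner_def cis_Suc_mod[OF j] right_diff_distrib cis_mult
    by (simp add: algebra_simps add_divide_distrib)
  also have "cis ?a - cis (- ?a) = of_real (2 * sin ?a) * \<i>" by (simp add: complex_eq_iff)
  finally have "norm (corner R k (Suc j mod k) - corner R k j) = \<bar>R\<bar> * \<bar>2 * sin ?a\<bar>"
    by (simp add: norm_mult abs_mult)
  also have "\<dots> = c" using pk c by (simp add: R)
  finally show ?thesis by (simp add: dist_norm norm_minus_commute)
qed

section \<open>Equilateral realisation of a tiling\<close>

text \<open>
  The maps \<open>polygon_point\<close> and \<open>disc_point\<close> have the same fibres on the space of cone coordinates, and
  the former is a quotient map because it is a surjection from a compact onto a Hausdorff space.  So
  \<open>\<phi>\<close> composed with \<open>disc_point\<close> descends to the polygon.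
\<close>

lemma face_map_regular_polygon:
  assumes k: "3 \<le> k" and R: "0 < R" and \<tau>: "\<And>j. j < k \<Longrightarrow> side_repar (\<tau> j)"
    and \<phi>: "face_map X T (cball 0 1) \<phi> f"
  obtains \<Phi> where "face_map X T (regular_polygon R k) \<Phi> f"
    and "\<And>j s. \<lbrakk>j < k; s \<in> {0..1}\<rbrakk> \<Longrightarrow>
      \<Phi> (side_point R k j s) = \<phi> (cis (2 * pi * (real j + \<tau> j s) / real k))"
proof -
  let ?P = "regular_polygon R k" and ?I = "cone_params k"
  let ?q = "polygon_point R k" and ?w = "disc_point k \<tau>"
  have q_img: "?q ` ?I = ?P" by (rule polygon_point_image[OF k R])
  have w_img: "?w ` ?I = cball 0 1" using k \<tau> by (intro disc_point_image) auto
  have q_cont: "continuous_on ?I ?q"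
    unfolding polygon_point_def side_point_def
    by (intro continuous_on_cone_params) (auto simp: case_prod_beta intro!: continuous_intros)
  have w_cont: "continuous_on ?I ?w"
  proof (rule continuous_on_cone_params)
    fix j assume "j < k"
    then have "continuous_on {0..1} (\<tau> j)" using \<tau> by (simp add: side_repar_def)
    then have "continuous_on ({0..1} \<times> {0..1}) (\<lambda>p::real \<times> real. \<tau> j (fst p))"
      by (rule continuous_on_compose2) (auto intro!: continuous_intros)
    then show "continuous_on ({0..1} \<times> {0..1}) (\<lambda>p. ?w (j, p))"
      using k unfolding disc_point_def case_prod_beta by (auto intro!: continuous_intros)
  qed
  have same_fibres: "?q p = ?q p' \<longleftrightarrow> ?w p = ?w p'" if "p \<in> ?I" "p' \<in> ?I" for p p'
    using that polygon_point_eq_iff[OF k R] disc_point_eq_iff[where \<tau> = \<tau>, OF \<tau>]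
    by (cases p; cases p') metis
  have quot: "quotient_map (top_of_set ?I) (top_of_set ?P) ?q"
  proof (rule T1_Spaces.continuous_imp_quotient_map)
    show "continuous_map (top_of_set ?I) (top_of_set ?P) ?q"
      using q_cont q_img by auto
    show "compact_space (top_of_set ?I)"
      by (rule compact_space_subtopology)
        (simp add: compactin_euclidean_iff compact_Times[OF finite_imp_compact[OF finite_lessThan] compact_Times[OF compact_Icc compact_Icc]])
    show "Hausdorff_space (top_of_set ?P)" by (simp add: Hausdorff_space_subtopology)
    show "?q ` topspace (top_of_set ?I) = topspace (top_of_set ?P)" using q_img by simp
  qed
  have "continuous_map (top_of_set ?I) (top_of_set (cball 0 1)) ?w" using w_cont w_img by auto
  then have g_cont: "continuous_map (top_of_set ?I) X (\<phi> \<circ> ?w)"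
    using continuous_map_compose \<phi> unfolding face_map_def by blast
  obtain \<Phi> where \<Phi>: "continuous_map (top_of_set ?P) X \<Phi>"
    "\<Phi> ` topspace (top_of_set ?P) = (\<phi> \<circ> ?w) ` topspace (top_of_set ?I)"
    and lift: "\<And>p. p \<in> topspace (top_of_set ?I) \<Longrightarrow> \<Phi> (?q p) = (\<phi> \<circ> ?w) p"
    by (rule quotient_map_lift_exists[OF quot g_cont]) (use same_fibres in auto)
  have img: "\<Phi> ` ?P = f" using \<Phi>(2) w_img \<phi> by (simp add: face_map_def flip: image_image)
  have inner: "\<exists>p\<in>?I. z = ?q p \<and> ?w p \<in> interior (cball 0 1)" if z: "z \<in> interior ?P" for z
  proof -
    have "z \<in> ?q ` ?I" unfolding q_img using z interior_subset by blast
    then obtain j s r where p: "(j, s, r) \<in> ?I" "z = ?q (j, s, r)" by auto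
    then have "r < 1" using polygon_point_interior[OF k R] z by blast
    then have "?w (j, s, r) \<in> interior (cball 0 1)" using p by (simp add: disc_point_def norm_mult)
    then show ?thesis using p by blast
  qed
  have "inj_on \<Phi> (interior ?P)"
  proof
    fix z z' assume z: "z \<in> interior ?P" and z': "z' \<in> interior ?P" and eq: "\<Phi> z = \<Phi> z'"
    obtain p p' where p: "p \<in> ?I" "z = ?q p" "?w p \<in> interior (cball 0 1)"
      and p': "p' \<in> ?I" "z' = ?q p'" "?w p' \<in> interior (cball 0 1)"
      using inner[OF z] inner[OF z'] by blast
    have "\<phi> (?w p) = \<phi> (?w p')" using eq lift[of p] lift[of p'] p p' by simp
    then have "?w p = ?w p'"
      using \<phi> p(3) p'(3) by (auto simp only: face_map_def dest: inj_onD)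
    then show "z = z'" using same_fibres p p' by simp
  qed
  moreover have "\<Phi> ` interior ?P \<inter> \<Union>(tarcs T) = {}"
  proof -
    have "\<Phi> ` interior ?P \<subseteq> \<phi> ` interior (cball 0 1)"
    proof clarify
      fix z assume "z \<in> interior ?P"
      from inner[OF this] obtain p where "p \<in> ?I" "z = ?q p" "?w p \<in> interior (cball 0 1)" by blast
      then show "\<Phi> z \<in> \<phi> ` interior (cball 0 1)" using lift[of p] by (simp del: interior_cball)
    qed
    then show ?thesis using \<phi> by (auto simp only: face_map_def)
  qed
  ultimately have "face_map X T ?P \<Phi> f" using \<Phi>(1) img by (simp add: face_map_def)
  moreover have "\<Phi> (side_point R k j s) = \<phi> (cis (2 * pi * (real j + \<tau> j s) / real k))"
    if "j < k" "s \<in> {0..1}" for j s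
    using lift[of "(j, s, 1)"] that by (simp add: polygon_point_def disc_point_def)
  ultimately show ?thesis by (rule that)
qed

lemma arc_reparametrisation:
  assumes X: "Hausdorff_space X" and g: "pathin X g" and h: "pathin X h" and inj: "inj_on g {0..1}" "inj_on h {0..1}"
    and img: "g ` {0..1} = h ` {0..1}" and ends: "g 0 = h 0" "g 1 = h 1"
  obtains \<tau> where "side_repar \<tau>" "\<And>s. s \<in> {0..1} \<Longrightarrow> h (\<tau> s) = g s"
proof -
  let ?I = "top_of_set {0..1::real}" and ?A = "subtopology X (h ` {0..1})"
  have sub: "h ` {0..1} \<subseteq> topspace X" using path_start_in_topspace h by (auto simp: pathin_def continuous_map_def)
  have "homeomorphic_map ?I ?A h"
    using h inj(2) X sub
    by (intro continuous_imp_homeomorphic_map)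
      (auto simp: pathin_def continuous_map_in_subtopology compact_space_subtopology Hausdorff_space_subtopology)
  then obtain h' where h': "homeomorphic_maps ?I ?A h h'" by (auto simp: homeomorphic_map_maps)
  define \<tau> where "\<tau> = h' \<circ> g"
  have "continuous_map ?I ?A g"
    using g img by (auto simp: pathin_def continuous_map_in_subtopology)
  then have "continuous_map ?I ?I \<tau>"
    unfolding \<tau>_def using h' unfolding homeomorphic_maps_def by (intro continuous_map_compose[of ?I ?A g]) blast+
  then have cont: "continuous_on {0..1} \<tau>" and into: "\<tau> \<in> {0..1} \<rightarrow> {0..1}" by auto
  have left: "h' (h s) = s" if "s \<in> {0..1}" for s using h' that by (simp add: homeomorphic_maps_def)
  have right: "h (\<tau> s) = g s" if "s \<in> {0..1}" for s
  proof -
    have "g s \<in> h ` {0..1}" using that img by blast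
    then show ?thesis using left by (auto simp: \<tau>_def)
  qed
  have "bij_betw \<tau> {0..1} {0..1}"
    unfolding bij_betw_def
  proof
    show "inj_on \<tau> {0..1}"
      by (rule inj_onI) (metis right inj(1) inj_onD)
    show "\<tau> ` {0..1} = {0..1}"
    proof
      show "\<tau> ` {0..1} \<subseteq> {0..1}" using into by auto
      show "{0..1} \<subseteq> \<tau> ` {0..1}"
      proof
        fix t :: real assume t: "t \<in> {0..1}"
        then obtain s where "s \<in> {0..1}" "g s = h t" using img by (metis image_iff)
        then show "t \<in> \<tau> ` {0..1}" using left[OF t] by (intro image_eqI[of _ _ s]) (auto simp: \<tau>_def)
      qed
    qed
  qed
  moreover have "\<tau> 0 = 0" "\<tau> 1 = 1" using left[of 0] left[of 1] ends by (auto simp: \<tau>_def)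
  ultimately show ?thesis using cont right by (intro that) (auto simp: side_repar_def)
qed

lemma pathin_reverse: "pathin X g \<Longrightarrow> pathin X (\<lambda>s. g (1 - s))"
  unfolding pathin_def
  using continuous_map_compose[of "top_of_set {0..1}" "top_of_set {0..1}" "\<lambda>s. 1 - s" X g]
  by (auto simp: o_def continuous_intros)

text \<open>
  Two parametrisations of one arc differ by a homeomorphism of the unit interval, up to a reversal;
  after the reversal the homeomorphism fixes both ends.
\<close>

lemma arc_matching:
  assumes X: "Hausdorff_space X" and g: "pathin X g" and h: "pathin X h" and inj: "inj_on g {0..1}" "inj_on h {0..1}"
    and img: "g ` {0..1} = h ` {0..1}" and ends: "{g 0, g 1} = {h 0, h 1}"
  shows "\<exists>\<tau>. side_repar \<tau> \<and> ((\<forall>s\<in>{0..1}. h (\<tau> s) = g s) \<or> (\<forall>s\<in>{0..1}. h (\<tau> s) = g (1 - s)))"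
proof -
  consider "g 0 = h 0" "g 1 = h 1" | "g 1 = h 0" "g 0 = h 1"
    using ends by (auto simp: doubleton_eq_iff)
  then show ?thesis
  proof cases
    case 1
    from arc_reparametrisation[OF X g h inj img 1]
    obtain \<tau> where "side_repar \<tau>" "\<And>s. s \<in> {0..1} \<Longrightarrow> h (\<tau> s) = g s" by blast
    then show ?thesis by (intro exI[of _ \<tau>]) simp
  next
    case 2
    have flip: "(\<lambda>s::real. 1 - s) ` {0..1} = {0..1}" by (simp add: image_diff_atLeastAtMost)
    have "inj_on (g \<circ> (\<lambda>s. 1 - s)) {0..1}"
      using inj(1) flip by (intro comp_inj_on) (auto simp: inj_on_def)
    then have "inj_on (\<lambda>s. g (1 - s)) {0..1}" by (simp add: o_def)
    moreover have "(\<lambda>s. g (1 - s)) ` {0..1} = h ` {0..1}"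
      using img flip image_image[of g "\<lambda>s. 1 - s" "{0..1}"] by simp
    moreover have "g (1 - 0) = h 0" "g (1 - 1) = h 1" using 2 by auto
    ultimately obtain \<tau> where "side_repar \<tau>" "\<And>s. s \<in> {0..1} \<Longrightarrow> h (\<tau> s) = g (1 - s)"
      using arc_reparametrisation[OF X pathin_reverse[OF g] h _ inj(2)] by blast
    then show ?thesis by (intro exI[of _ \<tau>]) simp
  qed
qed

lemma polygonal_face_equilateral:
  assumes X: "Hausdorff_space X" and f: "polygonal_face X T f" and c: "0 < c"
    and g: "\<And>a. a \<in> tarcs T \<Longrightarrow> pathin X (g a) \<and> inj_on (g a) {0..1} \<and> g a ` {0..1} = a \<and> a \<inter> tverts T = {g a 0, g a 1}"
  shows "\<exists>k p \<Phi>. convex_polygon k p \<and> face_map X T (convex hull (p ` {..<k})) \<Phi> f \<and>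
      (\<forall>j<k. \<exists>a\<in>tarcs T. dist (p j) (p (Suc j mod k)) = c \<and>
        ((\<forall>s\<in>{0..c}. \<Phi> (p j + of_real (s / c) * (p (Suc j mod k) - p j)) = g a (s / c)) \<or>
         (\<forall>s\<in>{0..c}. \<Phi> (p j + of_real (s / c) * (p (Suc j mod k) - p j)) = g a ((c - s) / c))))"
proof -
  obtain k \<phi> where k: "3 \<le> k" and \<phi>: "face_map X T (cball 0 1) \<phi> f"
    and sides: "\<forall>j<k. let side = (\<lambda>s::real. \<phi> (cis (2 * pi * (real j + s) / real k))) in
         inj_on side {0..1} \<and> side ` {0..1} \<in> tarcs T \<and> side ` {0..1} \<inter> tverts T = {side 0, side 1}"
    using f unfolding polygonal_face_def by (elim exE conjE)
  define side where "side j s = \<phi> (cis (2 * pi * (real j + s) / real k))" for j and s :: real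
  define arc where "arc j = side j ` {0..1}" for j
  have side: "inj_on (side j) {0..1}" "arc j \<in> tarcs T" "arc j \<inter> tverts T = {side j 0, side j 1}"
    if "j < k" for j
    using sides[rule_format, OF that] unfolding arc_def side_def[abs_def] Let_def by blast+
  have side_path: "pathin X (side j)" for j
  proof -
    have "continuous_map (top_of_set {0..1}) (top_of_set (cball 0 1)) (\<lambda>s::real. cis (2 * pi * (real j + s) / real k))"
      using k by (auto intro!: continuous_intros)
    then show ?thesis
      using continuous_map_compose[of "top_of_set {0..1}" "top_of_set (cball 0 1)" _ X \<phi>] \<phi>
      unfolding pathin_def face_map_def side_def[abs_def] o_def by blast
  qed
  have "\<exists>\<tau>. side_repar \<tau> \<and> ((\<forall>s\<in>{0..1}. side j (\<tau> s) = g (arc j) s) \<or>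
      (\<forall>s\<in>{0..1}. side j (\<tau> s) = g (arc j) (1 - s)))" if j: "j < k" for j
    using g[OF side(2)[OF j]] side(3)[OF j]
    by (intro arc_matching[OF X _ side_path _ side(1)[OF j]]) (simp_all add: arc_def)
  then have "\<forall>j. \<exists>\<tau>. j < k \<longrightarrow> side_repar \<tau> \<and> ((\<forall>s\<in>{0..1}. side j (\<tau> s) = g (arc j) s) \<or>
      (\<forall>s\<in>{0..1}. side j (\<tau> s) = g (arc j) (1 - s)))" by blast
  then obtain \<tau> where "\<forall>j. j < k \<longrightarrow> side_repar (\<tau> j) \<and> ((\<forall>s\<in>{0..1}. side j (\<tau> j s) = g (arc j) s) \<or>
      (\<forall>s\<in>{0..1}. side j (\<tau> j s) = g (arc j) (1 - s)))"
    by (rule choice[THEN exE])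
  then have \<tau>: "\<And>j. j < k \<Longrightarrow> side_repar (\<tau> j)"
    and match: "\<And>j. j < k \<Longrightarrow> (\<forall>s\<in>{0..1}. side j (\<tau> j s) = g (arc j) s) \<or>
      (\<forall>s\<in>{0..1}. side j (\<tau> j s) = g (arc j) (1 - s))" by blast+
  \<comment> \<open>The circumradius of the regular \<open>k\<close>-gon with side length \<open>c\<close>.\<close>
  define R where "R = c / (2 * sin (pi / real k))"
  have R: "0 < R" using c pi_div_k[OF k] by (simp add: R_def)
  from face_map_regular_polygon[where \<tau> = \<tau>, OF k R \<tau> \<phi>]
  obtain \<Phi> where \<Phi>: "face_map X T (regular_polygon R k) \<Phi> f"
    and \<Phi>_side: "\<And>j s. \<lbrakk>j < k; s \<in> {0..1}\<rbrakk> \<Longrightarrow> \<Phi> (side_point R k j s) = side j (\<tau> j s)"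
    unfolding side_def by blast
  have "\<exists>a\<in>tarcs T. dist (corner R k j) (corner R k (Suc j mod k)) = c \<and>
      ((\<forall>s\<in>{0..c}. \<Phi> (corner R k j + of_real (s / c) * (corner R k (Suc j mod k) - corner R k j)) = g a (s / c)) \<or>
       (\<forall>s\<in>{0..c}. \<Phi> (corner R k j + of_real (s / c) * (corner R k (Suc j mod k) - corner R k j)) = g a ((c - s) / c)))"
    if j: "j < k" for j
  proof (intro bexI conjI)
    show "dist (corner R k j) (corner R k (Suc j mod k)) = c" by (rule dist_corner[OF k c j R_def])
    show "arc j \<in> tarcs T" by (rule side(2)[OF j])
    have at: "\<Phi> (corner R k j + of_real (s / c) * (corner R k (Suc j mod k) - corner R k j)) = side j (\<tau> j (s / c))"
      and in01: "s / c \<in> {0..1}" if "s \<in> {0..c}" for s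
      using that c \<Phi>_side[OF j, of "s / c"] by (simp_all add: side_point_def)
    have rev: "(c - s) / c = 1 - s / c" for s using c by (simp add: diff_divide_distrib)
    from match[OF j]
    show "(\<forall>s\<in>{0..c}. \<Phi> (corner R k j + of_real (s / c) * (corner R k (Suc j mod k) - corner R k j)) = g (arc j) (s / c)) \<or>
       (\<forall>s\<in>{0..c}. \<Phi> (corner R k j + of_real (s / c) * (corner R k (Suc j mod k) - corner R k j)) = g (arc j) ((c - s) / c))"
    proof
      assume "\<forall>s\<in>{0..1}. side j (\<tau> j s) = g (arc j) s"
      then have "\<forall>s\<in>{0..c}. \<Phi> (corner R k j + of_real (s / c) * (corner R k (Suc j mod k) - corner R k j)) = g (arc j) (s / c)"
        using at in01 by metis
      then show ?thesis ..
    next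
      assume "\<forall>s\<in>{0..1}. side j (\<tau> j s) = g (arc j) (1 - s)"
      then have "\<forall>s\<in>{0..c}. \<Phi> (corner R k j + of_real (s / c) * (corner R k (Suc j mod k) - corner R k j)) = g (arc j) ((c - s) / c)"
        unfolding rev using at in01 by metis
      then show ?thesis ..
    qed
  qed
  then show ?thesis
    using convex_polygon_corner[OF k R] \<Phi> by (intro exI[of _ k] exI[of _ "corner R k"] exI[of _ \<Phi>] conjI) simp_all
qed

text \<open>
  Each arc gets one parametrisation \<open>\<gamma>\<close> by an interval of length \<open>c\<close>, and all faces are fitted to these
  same parametrisations; this is what makes the polygons glue isometrically along shared edges.
\<close>

theorem polygonal_tiling_equilateral:
  assumes X: "Hausdorff_space X" and T: "polygonal_tiling X T" and c: "0 < c"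
  shows "polygonal_partition_with_lengths X T (\<lambda>_. c)"
proof -
  have "\<forall>a\<in>tarcs T. \<exists>g. pathin X g \<and> inj_on g {0..1} \<and> g ` {0..1} = a \<and> a \<inter> tverts T = {g 0, g 1}"
    using T by (auto simp: polygonal_tiling_def tiling_arc_def)
  then obtain g where g: "\<And>a. a \<in> tarcs T \<Longrightarrow> pathin X (g a)" "\<And>a. a \<in> tarcs T \<Longrightarrow> inj_on (g a) {0..1}"
    "\<And>a. a \<in> tarcs T \<Longrightarrow> g a ` {0..1} = a" "\<And>a. a \<in> tarcs T \<Longrightarrow> a \<inter> tverts T = {g a 0, g a 1}"
    by metis
  define \<gamma> where "\<gamma> a s = g a (s / c)" for a s
  have \<gamma>: "homeomorphic_map (top_of_set {0..c}) (subtopology X a) (\<gamma> a)" if a: "a \<in> tarcs T" for a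
  proof (rule continuous_imp_homeomorphic_map)
    have scale: "(\<lambda>s. s / c) ` {0..c} = {0..1}"
      using c by (simp add: image_divide_atLeastAtMost)
    have \<gamma>_eq: "\<gamma> a = g a \<circ> (\<lambda>s. s / c)" by (simp add: fun_eq_iff \<gamma>_def)
    have img: "\<gamma> a ` {0..c} = a"
      unfolding \<gamma>_eq image_comp[symmetric] scale by (rule g(3)[OF a])
    have sub: "a \<subseteq> topspace X" 
      using continuous_map_image_subset_topspace[OF g(1)[OF a, unfolded pathin_def]]
      unfolding topspace_euclidean_subtopology g(3)[OF a] .
    have "continuous_map (top_of_set {0..c}) (top_of_set {0..1}) (\<lambda>s. s / c)"
      using c scale by (auto intro!: continuous_intros)
    then have "continuous_map (top_of_set {0..c}) X (\<gamma> a)"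
      unfolding \<gamma>_eq by (rule continuous_map_compose[OF _ g(1)[OF a, unfolded pathin_def]])
    then show "continuous_map (top_of_set {0..c}) (subtopology X a) (\<gamma> a)"
      using img by (auto simp: continuous_map_in_subtopology)
    show "\<gamma> a ` topspace (top_of_set {0..c}) = topspace (subtopology X a)"
      using img sub by auto
    have "inj_on (\<lambda>s. s / c) {0..c}" using c by (auto intro: inj_onI)
    then show "inj_on (\<gamma> a) (topspace (top_of_set {0..c}))"
      unfolding \<gamma>_eq using g(2)[OF a] scale by (intro comp_inj_on) simp_all
  qed (use X in \<open>auto simp: compact_space_subtopology Hausdorff_space_subtopology\<close>)
  have "polygonal_face X T f" if "f \<in> tfaces T" for f
    using T that by (simp add: polygonal_tiling_def)
  note faces = polygonal_face_equilateral[OF X this c, of _ g]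
  show ?thesis
    unfolding polygonal_partition_with_lengths_def Let_def
  proof (intro conjI exI[of _ \<gamma>] ballI)
    fix f assume "f \<in> tfaces T"
    show "\<exists>k p \<Phi>. convex_polygon k p \<and> face_map X T (convex hull (p ` {..<k})) \<Phi> f \<and>
      (\<forall>j<k. \<exists>a\<in>tarcs T. dist (p j) (p (Suc j mod k)) = c \<and>
        ((\<forall>s\<in>{0..c}. \<Phi> (p j + of_real (s / c) * (p (Suc j mod k) - p j)) = \<gamma> a s) \<or>
         (\<forall>s\<in>{0..c}. \<Phi> (p j + of_real (s / c) * (p (Suc j mod k) - p j)) = \<gamma> a (c - s))))"
      unfolding \<gamma>_def by (rule faces[OF \<open>f \<in> tfaces T\<close>]) (use g in blast)
  qed (use T c \<gamma> in simp_all)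
qed

section \<open>Degrees and the logarithmic form of the curvature flow\<close>

lemma bij_betw_nbrs_incident:
  assumes G: "simple_graph V E" shows "bij_betw (\<lambda>y. {x, y}) (nbrs E x) (incident E x)"
  unfolding bij_betw_def
proof
  show "inj_on (\<lambda>y. {x, y}) (nbrs E x)" by (auto simp: inj_on_def doubleton_eq_iff)
  show "(\<lambda>y. {x, y}) ` nbrs E x = incident E x"
  proof
    show "incident E x \<subseteq> (\<lambda>y. {x, y}) ` nbrs E x"
    proof
      fix e assume e: "e \<in> incident E x"
      then have "card e = 2" "x \<in> e" using G by (auto simp: incident_def simple_graph_def)
      then obtain y where "e = {x, y}" by (auto simp: card_2_iff)
      then show "e \<in> (\<lambda>y. {x, y}) ` nbrs E x" using e by (auto simp: nbrs_def incident_def)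
    qed
  qed (auto simp: nbrs_def incident_def)
qed

lemma card_incident: "simple_graph V E \<Longrightarrow> card (incident E x) = card (nbrs E x)"
  using bij_betw_same_card[OF bij_betw_nbrs_incident] by metis

lemma vertex_weight_incident:
  "simple_graph V E \<Longrightarrow> vertex_weight E \<omega> x = (\<Sum>e\<in>incident E x. \<omega> e)"
  unfolding vertex_weight_def by (rule sum.reindex_bij_betw[OF bij_betw_nbrs_incident])

lemma edge_cases:
  assumes "simple_graph V E" "e \<in> E" obtains x y where "e = {x, y}" "x \<noteq> y" "x \<in> V" "y \<in> V"
  using assms by (auto simp: simple_graph_def card_2_iff)

text \<open>
  In both cases the sum is the same for all edges.  Summing it over all edges counts every vertex
  once, which identifies its value.
\<close>

lemma reciprocal_degree_sum:
  assumes G: "simple_graph V E" and no_isolated: "\<And>x. x \<in> V \<Longrightarrow> incident E x \<noteq> {}"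
    and deg: "regular_graph V E \<or> semiregular_bipartite V E" and e: "e \<in> E"
  shows "(\<Sum>x\<in>e. 1 / real (card (incident E x))) = real (card V) / real (card E)"
proof -
  obtain K where K: "\<And>e. e \<in> E \<Longrightarrow> (\<Sum>x\<in>e. 1 / real (card (incident E x))) = K"
  proof -
    from deg show ?thesis
    proof
      assume "regular_graph V E"
      then obtain k where k: "\<And>x. x \<in> V \<Longrightarrow> card (nbrs E x) = k" by (auto simp: regular_graph_def)
      have "(\<Sum>x\<in>e. 1 / real (card (incident E x))) = 2 / real k" if "e \<in> E" for e
      proof -
        obtain x y where "e = {x, y}" "x \<noteq> y" "x \<in> V" "y \<in> V" by (rule edge_cases[OF G \<open>e \<in> E\<close>])
        then show ?thesis using k by (simp add: card_incident[OF G])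
      qed
      then show ?thesis by (rule that)
    next
      assume "semiregular_bipartite V E"
      then obtain Va Vb a b where disj: "Va \<inter> Vb = {}" and bip: "\<forall>e\<in>E. \<exists>x\<in>Va. \<exists>y\<in>Vb. e = {x, y}"
        and ab: "\<forall>x\<in>Va. card (nbrs E x) = a" "\<forall>y\<in>Vb. card (nbrs E y) = b"
        unfolding semiregular_bipartite_def by (elim exE conjE)
      have "(\<Sum>x\<in>e. 1 / real (card (incident E x))) = 1 / real a + 1 / real b" if "e \<in> E" for e
      proof -
        obtain x y where e: "e = {x, y}" "x \<in> Va" "y \<in> Vb" using bip \<open>e \<in> E\<close> by blast
        then have "x \<noteq> y" using disj by blast
        then show ?thesis using e ab by (simp add: card_incident[OF G])
      qed
      then show ?thesis by (rule that)
    qed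
  qed
  have "K * real (card E) = real (card V)"
    using sum_reciprocal_degrees[OF G no_isolated] K by (simp add: mult.commute)
  moreover have "real (card E) \<noteq> 0" using e finite_edges[OF G] by auto
  ultimately show ?thesis using K[OF e] by (simp add: field_simps)
qed

lemma flow_rate:
  assumes G: "simple_graph V E" and g: "girth E > 5" and xy: "{x, y} \<in> E" and pos: "\<And>e. e \<in> E \<Longrightarrow> \<omega> e > 0"
  shows "- (lly_curvature V E \<omega> x y - average_curvature V E)
    = 2 * (real (card V) / real (card E) - (\<Sum>z\<in>{x, y}. softmax (incident E z) (\<lambda>e. ln (\<omega> e)) {x, y}))"
proof -
  have sm: "softmax (incident E z) (\<lambda>e. ln (\<omega> e)) {x, y} = \<omega> {x, y} / vertex_weight E \<omega> z" for z
  proof -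
    have "(\<Sum>e\<in>incident E z. exp (ln (\<omega> e))) = (\<Sum>e\<in>incident E z. \<omega> e)"
      using pos by (intro sum.cong) (auto simp: incident_def)
    then show ?thesis using pos[OF xy] by (simp add: softmax_def vertex_weight_incident[OF G])
  qed
  have "lly_curvature V E \<omega> x y = 2 * \<omega> {x, y} * (1 / vertex_weight E \<omega> x + 1 / vertex_weight E \<omega> y) - 2"
    by (rule lly_curvature_girth_gt_5[OF G g xy pos])
  then show ?thesis
    unfolding average_curvature_def using edge_neq(1)[OF G xy] by (simp add: sm algebra_simps)
qed

lemma flow_solution_ln:
  assumes G: "simple_graph V E" and g: "girth E > 5" and \<omega>: "flow_solution V E \<omega>0 \<omega>"
  shows "log_flow E (real (card V) / real (card E)) (\<lambda>t e. ln (\<omega> t e))"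
  unfolding log_flow_def
proof (intro allI impI ballI)
  fix t :: real and e assume t: "0 \<le> t" and e: "e \<in> E"
  obtain x y where xy: "e = {x, y}" using edge_cases[OF G e] by blast
  have pos: "\<And>e. e \<in> E \<Longrightarrow> \<omega> t e > 0" using \<omega> t by (auto simp: flow_solution_def)
  have "((\<lambda>s. \<omega> s e) has_real_derivative - (lly_curvature V E (\<omega> t) x y - average_curvature V E) * \<omega> t e) (at t within {0..})"
    using \<omega> t e unfolding flow_solution_def xy by blast
  from DERIV_chain2[OF DERIV_ln_divide[OF pos[OF e]] this]
  have "((\<lambda>s. ln (\<omega> s e)) has_real_derivative - (lly_curvature V E (\<omega> t) x y - average_curvature V E)) (at t within {0..})"
    using pos[OF e] by simp
  also have "- (lly_curvature V E (\<omega> t) x y - average_curvature V E)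
      = 2 * (real (card V) / real (card E) - (\<Sum>x\<in>e. softmax (incident E x) (\<lambda>e. ln (\<omega> t e)) e))"
    unfolding xy by (rule flow_rate[OF G g _ pos]) (use e xy in auto)
  finally show "((\<lambda>s. ln (\<omega> s e)) has_real_derivative
      2 * (real (card V) / real (card E) - (\<Sum>x\<in>e. softmax (incident E x) (\<lambda>e. ln (\<omega> t e)) e))) (at t within {0..})" .
qed

text \<open>
  Exponentials of a solution in logarithmic coordinates are positive without further argument, so
  the flow never leaves the space of weights.
\<close>

lemma flow_solution_exp:
  assumes G: "simple_graph V E" and g: "girth E > 5"
    and u: "log_flow E (real (card V) / real (card E)) u" and init: "\<And>e. e \<in> E \<Longrightarrow> exp (u 0 e) = \<omega>0 e"
  shows "flow_solution V E \<omega>0 (\<lambda>t e. exp (u t e))"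
  unfolding flow_solution_def
proof (intro conjI allI impI ballI)
  fix t :: real and x y assume t: "0 \<le> t" and xy: "{x, y} \<in> E"
  have "((\<lambda>s. u s {x, y}) has_real_derivative 2 * (real (card V) / real (card E) -
      (\<Sum>z\<in>{x, y}. softmax (incident E z) (u t) {x, y}))) (at t within {0..})"
    using u t xy unfolding log_flow_def by blast
  from DERIV_chain2[OF DERIV_exp this]
  have "((\<lambda>s. exp (u s {x, y})) has_real_derivative exp (u t {x, y}) *
      (2 * (real (card V) / real (card E) - (\<Sum>z\<in>{x, y}. softmax (incident E z) (u t) {x, y})))) (at t within {0..})" .
  then show "((\<lambda>s. exp (u s {x, y})) has_real_derivative
      - (lly_curvature V E (\<lambda>e. exp (u t e)) x y - average_curvature V E) * exp (u t {x, y})) (at t within {0..})"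
    using flow_rate[OF G g xy, of "\<lambda>e. exp (u t e)"] by (simp add: mult.commute)
qed (use init in auto)

theorem corollary1p1:
  fixes M :: "'a set" and d :: "'a \<Rightarrow> 'a \<Rightarrow> real"
    and T :: "'a tiling" and \<omega>0 :: "'a set \<Rightarrow> real"
  defines "X \<equiv> Metric_space.mtopology M d"
    and "V \<equiv> tverts T" and "E \<equiv> skeleton_edges T"
  assumes surface: "closed_geodesic_surface M d"
    and tiling: "polygonal_tiling X T"
    and initial: "\<And>x y. {x, y} \<in> E \<Longrightarrow> \<omega>0 {x, y} = d x y"
    and degrees: "regular_graph V E \<or> semiregular_bipartite V E"
    and girth: "girth E > 5"
  shows "\<exists>\<omega>. flow_solution V E \<omega>0 \<omega> \<and>
           (\<forall>\<omega>'. flow_solution V E \<omega>0 \<omega>' \<longrightarrow> (\<forall>t\<ge>0. \<forall>e\<in>E. \<omega>' t e = \<omega> t e)) \<and>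
           (\<exists>c>0. (\<forall>e\<in>E. ((\<lambda>t. \<omega> t e) \<longlongrightarrow> c) at_top) \<and>
              polygonal_partition_with_lengths X T (\<lambda>_. c))"
proof -
  interpret Metric_space M d using surface by (simp add: closed_geodesic_surface_def)
  have G: "simple_graph V E" and conn: "connected_graph V E"
    using tiling by (simp_all add: polygonal_tiling_def V_def E_def)
  have no_isolated: "incident E x \<noteq> {}" if "x \<in> V" for x
  proof -
    have "V \<subseteq> \<Union>(tarcs T)" using tiling by (simp add: polygonal_tiling_def V_def)
    then obtain a where "a \<in> tarcs T" "x \<in> a" using \<open>x \<in> V\<close> by blast
    then have "a \<inter> V \<in> incident E x" using \<open>x \<in> V\<close> by (auto simp: incident_def E_def V_def skeleton_edges_def)
    then show ?thesis by blast
  qed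
  define K where "K = real (card V) / real (card E)"
  have K: "(\<Sum>x\<in>e. 1 / real (card (incident E x))) = K" if "e \<in> E" for e
    unfolding K_def by (rule reciprocal_degree_sum[OF G no_isolated degrees that])
  have "V \<subseteq> M"
  proof
    fix x assume "x \<in> V"
    then obtain a where a: "a \<in> tarcs T" "x \<in> a" using tiling by (auto simp: polygonal_tiling_def V_def)
    then have "tiling_arc X T a" using tiling by (simp add: polygonal_tiling_def)
    then obtain g where g: "pathin X g" "g ` {0..1} = a" by (auto simp: tiling_arc_def)
    have "a \<subseteq> topspace X"
      using continuous_map_image_subset_topspace[OF g(1)[unfolded pathin_def]]
      unfolding topspace_euclidean_subtopology g(2) .
    then show "x \<in> M" using a by (auto simp: X_def)
  qed
  have \<omega>0_pos: "\<omega>0 e > 0" if e: "e \<in> E" for e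
  proof -
    obtain x y where xy: "e = {x, y}" "x \<noteq> y" "x \<in> V" "y \<in> V" using edge_cases[OF G e] .
    then have "\<omega>0 e = d x y" using initial[of x y] e by simp
    also have "d x y > 0" using xy \<open>V \<subseteq> M\<close> by (intro mdist_pos_less) auto
    finally show ?thesis .
  qed
  obtain u where u: "log_flow E K u" and u0: "\<forall>e\<in>E. u 0 e = ln (\<omega>0 e)"
    using log_flow_exists[OF G, of K "\<lambda>e. ln (\<omega>0 e)"] by blast
  define \<omega> where "\<omega> t e = exp (u t e)" for t e
  define c where "c = exp ((\<Sum>e\<in>E. u 0 e) / real (card E))"
  have "flow_solution V E \<omega>0 \<omega>"
    unfolding \<omega>_def[abs_def] using u u0 \<omega>0_pos by (intro flow_solution_exp G girth) (auto simp: K_def)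
  moreover have "\<omega>' t e = \<omega> t e" if \<omega>': "flow_solution V E \<omega>0 \<omega>'" and t: "0 \<le> t" and e: "e \<in> E" for \<omega>' t e
  proof -
    have "log_flow E K (\<lambda>t e. ln (\<omega>' t e))"
      unfolding K_def by (rule flow_solution_ln[OF G girth \<omega>'])
    then have "ln (\<omega>' t e) = u t e"
      using log_flow_unique[OF G _ u _ t e, of "\<lambda>t e. ln (\<omega>' t e)"] \<omega>' u0 by (simp add: flow_solution_def)
    moreover have "\<omega>' t e > 0" using \<omega>' t e by (simp add: flow_solution_def)
    ultimately show ?thesis by (metis \<omega>_def exp_ln)
  qed
  moreover have "((\<lambda>t. \<omega> t e) \<longlongrightarrow> c) at_top" if "e \<in> E" for e
    unfolding \<omega>_def c_def by (intro tendsto_exp log_flow_converges[OF G conn no_isolated K u that])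
  moreover have "polygonal_partition_with_lengths X T (\<lambda>_. c)"
    using tiling by (intro polygonal_tiling_equilateral) (auto simp: X_def c_def Hausdorff_space_mtopology)
  moreover have "c > 0" by (simp add: c_def)
  ultimately show ?thesis by blast
qed

end
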